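(* The two automorphisms $d_1,I:\mathcal A_{q,t}\to\mathcal A_{q,t}$ define an action of the mapping class group $\mathrm{Mod}(\Sigma_2)$ of the closed genus two surface on $\mathcal A_{q,t}$. That is, there is a group homomorphism $\mathrm{Mod}(\Sigma_2)\to\mathrm{Aut}_{\mathbf k}(\mathcal A_{q,t})$ sending, for $1\le i\le 5$, the Dehn twist generator $d_i$ to the automorphism $I^{\,i-1}\circ d_1\circ I^{\,1-i}$, and sending the mapping class $d_1d_2d_3d_4d_5$ to the automorphism $I$.
   Context: Algebra $\mathcal A_{q,t}$. Let $\mathbf k=\mathbb C(q^{1/4},t^{1/4})$ and $[A,B]_{q^j}=\dfrac{q^{j/4}AB-q^{-j/4}BA}{q^{1/2}-q^{-1/2}}$ for $j\in\mathbb Z$ (with $[A,B]_q=[A,B]_{q^1}$). $\mathcal A_{q,t}$ is the associative unital $\mathbf k$-algebra with 15 generators $O_1,\dots,O_6$, $O_{12},O_{23},O_{34},O_{45},O_{56},O_{61}$, $O_{123},O_{234},O_{345}$. Indices are read cyclically modulo 6 with values in $\{1,\dots,6\}$, and $O_{456}:=O_{123}$, $O_{561}:=O_{234}$, $O_{612}:=O_{345}$. Put $\theta=(q+t)q^{-1/2}t^{-1/2}$. The defining relations are, for all $i$ modulo 6: (R1) $[O_i,O_{i+1}]_q=O_{i,i+1}$; $O_iO_j=O_jO_i$ if $i-j\not\equiv0,\pm1$ mod 6. (R2) $[O_{i,i+1},O_i]_q=O_{i+1}$; $[O_{i+1},O_{i,i+1}]_q=O_i$; $[O_{i,i+1},O_{i+2}]_q=O_{i,i+1,i+2}$;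 $[O_{i-1},O_{i,i+1}]_q=O_{i-1,i,i+1}$; $O_{i,i+1}$ commutes with $O_{i+3}$ and $O_{i+4}$. (R3) $[O_{i,i+1,i+2},O_i]_q=O_{i+1,i+2}$; $[O_{i+2},O_{i,i+1,i+2}]_q=O_{i,i+1}$; $O_{i,i+1,i+2}$ commutes with $O_{i+1}$. (R4) $[O_{i+1,i+2},O_{i,i+1}]_{q^2}=q^{-1/2}(q+1)O_iO_{i+2}-\theta O_{i+4}$; $[O_{i,i+1},O_{i+2,i+3}]_q=O_{i+4,i+5}$; $O_{i,i+1}$ commutes with $O_{i+3,i+4}$. (R5) $[O_{i,i+1,i+2},O_{i,i+1}]_q=O_{i+2}$; $[O_{i+1,i+2},O_{i,i+1,i+2}]_q=O_i$; $[O_{i,i+1,i+2},O_{i+2,i+3}]_{q^0}=O_{i+2}O_{i+4,i+5}-O_{i+3}O_{i,i+1}$. (R6) $[O_{123},O_{345}]_{q^2}=-\theta O_1O_5O_6+\theta q^{-1/4}O_5O_{61}+\theta q^{1/4}O_1O_{56}-\theta O_{234}+q^{-1/2}(q+1)O_3O_6$; $[O_{234},O_{123}]_{q^2}=-\theta O_2O_6O_1+\theta q^{-1/4}O_6O_{12}+\theta q^{1/4}O_2O_{61}-\theta O_{345}+q^{-1/2}(q+1)O_4O_1$; $[O_{345},O_{234}]_{q^2}=-\theta O_3O_1O_2+\theta q^{-1/4}O_1O_{23}+\theta q^{1/4}O_3O_{12}-\theta O_{123}+q^{-1/2}(q+1)O_5O_2$. (R7, $q$-Casimir) $\frac13(O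_{123}O_{234}O_{345}+O_{234}O_{345}O_{123}+O_{345}O_{123}O_{234})-\frac16q^{-1/2}(q^2+2)(O_1O_4O_{345}+O_2O_5O_{123}+O_3O_6O_{234}+O_4O_1O_{345}+O_5O_2O_{123}+O_6O_3O_{234})+\frac16q^{-5/4}t^{-1/2}(2q+1)(q+t)(O_1O_6O_{61}+O_2O_1O_{12}+O_3O_2O_{23}+O_4O_3O_{34}+O_5O_4O_{45}+O_6O_5O_{56})-\frac13q^{1/2}(O_1O_3O_5+O_2O_4O_6+O_3O_5O_1+O_4O_6O_2+O_5O_1O_3+O_6O_2O_4)-\frac16q^{-3/2}t^{-1/2}(2q+1)(q+t)(O_{12}^2+O_{23}^2+O_{34}^2+O_{45}^2+O_{56}^2+O_{61}^2)+\frac16q^{-3/2}t^{-1/2}(q-1)(q+t)(O_1^2+\dots+O_6^2)+q^{-3/2}t^{-3/2}(t+1)(q+t)(q^2+t)=0$. Automorphisms. $I$ is the $\mathbf k$-algebra automorphism of $\mathcal A_{q,t}$ permuting generators cyclically: $O_i\mapsto O_{i+1}$, $O_{i,i+1}\mapsto O_{i+1,i+2}$, $O_{123}\mapsto O_{234}\mapsto O_{345}\mapsto O_{123}$. $d_1$ is the $\mathbf k$-algebra automorphism given on generators by $O_2\mapsto q^{1/4}O_1O_2-q^{1/2}O_{12}$, $O_6\mapsto O_{61}$, $O_{12}\mapsto O_2$, $O_{23}\mapsto q^{1/4}O_1O_{23}-q^{1/2}O_{123}$, $O_{56}\mapsto O_{234}$, $O_{61}\mapsto q^{1/4}O_1O_{61}-q^{1/2}O_6$,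 $O_{123}\mapsto O_{23}$, $O_{234}\mapsto q^{1/4}O_1O_{234}-q^{1/2}O_{56}$, all other generators being fixed. Automorphisms are composed as functions. Mapping class group. $\mathrm{Mod}(\Sigma_2)$ is generated by Dehn twists $d_1,\dots,d_5$ along a chain of five simple closed curves, with relations $d_id_{i+1}d_i=d_{i+1}d_id_{i+1}$ ($1\le i\le4$), $d_id_j=d_jd_i$ ($|i-j|>1$), $I^6=1$, $H^2=1$, $Hd_i=d_iH$, where $I=d_1d_2d_3d_4d_5$ and $H=d_1d_2d_3d_4d_5d_5d_4d_3d_2d_1$. *)

theory Defs
  imports
    "HOL-Algebra.Group"
    "HOL-Computational_Algebra.Polynomial"
    "HOL-Computational_Algebra.Fraction_Field"
    "HOL-Library.Poly_Mapping"
begin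

section \<open>The ground field\<close>

text \<open>The field of rational functions over the complex numbers in two independent
  indeterminates, which play the roles of \<open>q\<^sup>1\<^sup>/\<^sup>4\<close> and \<open>t\<^sup>1\<^sup>/\<^sup>4\<close>.
  Thus \<open>qp j\<close> is \<open>q\<close> to the power \<open>j/4\<close>, and similarly for \<open>tp j\<close>.\<close>

type_synonym kfield = "complex poly poly fract"

definition q_root :: kfield where "q_root = Fract [:[:0, 1:]:] 1"
definition t_root :: kfield where "t_root = Fract [:0, 1:] 1"

definition qp :: "int \<Rightarrow> kfield" where "qp j = q_root powi j"
definition tp :: "int \<Rightarrow> kfield" where "tp j = t_root powi j"

abbreviation q :: kfield where "q \<equiv> qp 4"
abbreviation t :: kfield where "t \<equiv> tp 4"

definition \<theta> :: kfield where "\<theta> = (q + t) * qp (-2) * tp (-2)"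


section \<open>The free associative algebra\<close>

text \<open>The free monoid, written additively, so that finitely supported functions on it
  carry the convolution product.\<close>

datatype 'g nc_monomial = NC (letters: "'g list")

instantiation nc_monomial :: (type) monoid_add
begin

definition zero_nc_monomial :: "'a nc_monomial" where "0 = NC []"

definition plus_nc_monomial :: "'a nc_monomial \<Rightarrow> 'a nc_monomial \<Rightarrow> 'a nc_monomial"
  where "u + v = NC (letters u @ letters v)"

instance
  by intro_classes (simp_all add: zero_nc_monomial_def plus_nc_monomial_def)

end

datatype gen = O1 | O2 | O3 | O4 | O5 | O6
  | O12 | O23 | O34 | O45 | O56 | O61
  | O123 | O234 | O345

type_synonym free_alg = "gen nc_monomial \<Rightarrow>\<^sub>0 kfield"

definition X :: "gen \<Rightarrow> free_alg" where "X g = Poly_Mapping.single (NC [g]) 1"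

definition scaleF :: "kfield \<Rightarrow> free_alg \<Rightarrow> free_alg" (infixr "*\<^sub>F" 75)
  where "c *\<^sub>F f = Poly_Mapping.map ((*) c) f"

definition qbr :: "int \<Rightarrow> free_alg \<Rightarrow> free_alg \<Rightarrow> free_alg"
  where "qbr j A B = (1 / (qp 2 - qp (-2))) *\<^sub>F (qp j *\<^sub>F (A * B) - qp (-j) *\<^sub>F (B * A))"


section \<open>The defining relations\<close>

text \<open>Generators with a cyclic index: \<open>A1 i\<close>, \<open>A2 i\<close>, \<open>A3 i\<close> stand for
  \<open>O\<^sub>i\<close>, \<open>O\<^bsub>i,i+1\<^esub>\<close>, \<open>O\<^bsub>i,i+1,i+2\<^esub>\<close>.
  The index of \<open>A3\<close> has period 3 because of
  \<open>O\<^sub>4\<^sub>5\<^sub>6 = O\<^sub>1\<^sub>2\<^sub>3\<close>, \<open>O\<^sub>5\<^sub>6\<^sub>1 = O\<^sub>2\<^sub>3\<^sub>4\<close>, \<open>O\<^sub>6\<^sub>1\<^sub>2 = O\<^sub>3\<^sub>4\<^sub>5\<close>.\<close>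

definition A1 :: "int \<Rightarrow> free_alg"
  where "A1 i = X ([O1, O2, O3, O4, O5, O6] ! nat ((i - 1) mod 6))"

definition A2 :: "int \<Rightarrow> free_alg"
  where "A2 i = X ([O12, O23, O34, O45, O56, O61] ! nat ((i - 1) mod 6))"

definition A3 :: "int \<Rightarrow> free_alg"
  where "A3 i = X ([O123, O234, O345] ! nat ((i - 1) mod 3))"

definition q_casimir :: free_alg where
  "q_casimir =
     (1/3) *\<^sub>F (X O123 * X O234 * X O345 + X O234 * X O345 * X O123 + X O345 * X O123 * X O234)
   - (1/6 * qp (-2) * (q^2 + 2)) *\<^sub>F
       (X O1 * X O4 * X O345 + X O2 * X O5 * X O123 + X O3 * X O6 * X O234
        + X O4 * X O1 * X O345 + X O5 * X O2 * X O123 + X O6 * X O3 * X O234)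
   + (1/6 * qp (-5) * tp (-2) * (2 * q + 1) * (q + t)) *\<^sub>F
       (X O1 * X O6 * X O61 + X O2 * X O1 * X O12 + X O3 * X O2 * X O23
        + X O4 * X O3 * X O34 + X O5 * X O4 * X O45 + X O6 * X O5 * X O56)
   - (1/3 * qp 2) *\<^sub>F
       (X O1 * X O3 * X O5 + X O2 * X O4 * X O6 + X O3 * X O5 * X O1
        + X O4 * X O6 * X O2 + X O5 * X O1 * X O3 + X O6 * X O2 * X O4)
   - (1/6 * qp (-6) * tp (-2) * (2 * q + 1) * (q + t)) *\<^sub>F
       ((X O12)^2 + (X O23)^2 + (X O34)^2 + (X O45)^2 + (X O56)^2 + (X O61)^2)
   + (1/6 * qp (-6) * tp (-2) * (q - 1) * (q + t)) *\<^sub>F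
       ((X O1)^2 + (X O2)^2 + (X O3)^2 + (X O4)^2 + (X O5)^2 + (X O6)^2)
   + (qp (-6) * tp (-6) * (t + 1) * (q + t) * (q^2 + t)) *\<^sub>F 1"

inductive defrel :: "free_alg \<Rightarrow> free_alg \<Rightarrow> bool" (infix "\<doteq>" 50) where
  R1a: "qbr 1 (A1 i) (A1 (i+1)) \<doteq> A2 i"
| R1b: "(i - j) mod 6 \<notin> {0, 1, 5} \<Longrightarrow> A1 i * A1 j \<doteq> A1 j * A1 i"
| R2a: "qbr 1 (A2 i) (A1 i) \<doteq> A1 (i+1)"
| R2b: "qbr 1 (A1 (i+1)) (A2 i) \<doteq> A1 i"
| R2c: "qbr 1 (A2 i) (A1 (i+2)) \<doteq> A3 i"
| R2d: "qbr 1 (A1 (i-1)) (A2 i) \<doteq> A3 (i-1)"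
| R2e: "A2 i * A1 (i+3) \<doteq> A1 (i+3) * A2 i"
| R2f: "A2 i * A1 (i+4) \<doteq> A1 (i+4) * A2 i"
| R3a: "qbr 1 (A3 i) (A1 i) \<doteq> A2 (i+1)"
| R3b: "qbr 1 (A1 (i+2)) (A3 i) \<doteq> A2 i"
| R3c: "A3 i * A1 (i+1) \<doteq> A1 (i+1) * A3 i"
| R4a: "qbr 2 (A2 (i+1)) (A2 i) \<doteq> (qp (-2) * (q + 1)) *\<^sub>F (A1 i * A1 (i+2)) - \<theta> *\<^sub>F A1 (i+4)"
| R4b: "qbr 1 (A2 i) (A2 (i+2)) \<doteq> A2 (i+4)"
| R4c: "A2 i * A2 (i+3) \<doteq> A2 (i+3) * A2 i"
| R5a: "qbr 1 (A3 i) (A2 i) \<doteq> A1 (i+2)"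
| R5b: "qbr 1 (A2 (i+1)) (A3 i) \<doteq> A1 i"
| R5c: "qbr 0 (A3 i) (A2 (i+2)) \<doteq> A1 (i+2) * A2 (i+4) - A1 (i+3) * A2 i"
| R6a: "qbr 2 (X O123) (X O345) \<doteq>
    - (\<theta> *\<^sub>F (X O1 * X O5 * X O6)) + (\<theta> * qp (-1)) *\<^sub>F (X O5 * X O61)
    + (\<theta> * qp 1) *\<^sub>F (X O1 * X O56) - \<theta> *\<^sub>F X O234 + (qp (-2) * (q + 1)) *\<^sub>F (X O3 * X O6)"
| R6b: "qbr 2 (X O234) (X O123) \<doteq>
    - (\<theta> *\<^sub>F (X O2 * X O6 * X O1)) + (\<theta> * qp (-1)) *\<^sub>F (X O6 * X O12)
    + (\<theta> * qp 1) *\<^sub>F (X O2 * X O61) - \<theta> *\<^sub>F X O345 + (qp (-2) * (q + 1)) *\<^sub>F (X O4 * X O1)"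
| R6c: "qbr 2 (X O345) (X O234) \<doteq>
    - (\<theta> *\<^sub>F (X O3 * X O1 * X O2)) + (\<theta> * qp (-1)) *\<^sub>F (X O1 * X O23)
    + (\<theta> * qp 1) *\<^sub>F (X O3 * X O12) - \<theta> *\<^sub>F X O123 + (qp (-2) * (q + 1)) *\<^sub>F (X O5 * X O2)"
| R7: "q_casimir \<doteq> 0"


section \<open>The algebra\<close>

text \<open>The two-sided ideal generated by the differences of the two sides of the relations.
  Scalar multiples are covered by \<open>mult\<close>, scalars being elements of the free algebra.\<close>

inductive_set rel_ideal :: "free_alg set" where
  rel: "f \<doteq> g \<Longrightarrow> f - g \<in> rel_ideal"
| zero: "0 \<in> rel_ideal"
| add: "f \<in> rel_ideal \<Longrightarrow> g \<in> rel_ideal \<Longrightarrow> f + g \<in> rel_ideal"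
| mult: "f \<in> rel_ideal \<Longrightarrow> a * f * b \<in> rel_ideal"

lemma scaleF_conv_mult: "c *\<^sub>F f = Poly_Mapping.single 0 c * f"
  unfolding scaleF_def by (rule mult_map_scale_conv_mult)

lemma single_zero_central: "Poly_Mapping.single 0 c * f = f * Poly_Mapping.single 0 c"
  for f :: free_alg
proof (induction f rule: update_induct)
  case (update f k v)
  then have "Poly_Mapping.lookup f k = 0"
    by (simp add: in_keys_iff)
  then have "Poly_Mapping.update k v f = f + Poly_Mapping.single k v"
    by (intro poly_mapping_eqI) (auto simp: lookup_update lookup_add lookup_single when_def)
  moreover have "Poly_Mapping.single 0 c * Poly_Mapping.single k v
      = Poly_Mapping.single k v * Poly_Mapping.single 0 c"
    by (simp add: mult_single mult.commute)
  ultimately show ?case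
    using update by (simp add: algebra_simps)
qed simp

lemma module_scaleF: "module scaleF"
  by standard (simp_all add: scaleF_conv_mult distrib_left single_add distrib_right
      mult.assoc [symmetric] mult_single)

lemma scaleF_mult_left: "(c *\<^sub>F f) * g = c *\<^sub>F (f * g)"
  by (simp add: scaleF_conv_mult mult.assoc)

lemma scaleF_mult_right: "f * (c *\<^sub>F g) = c *\<^sub>F (f * g)"
  by (metis scaleF_conv_mult mult.assoc single_zero_central)

lemma rel_ideal_left: "f \<in> rel_ideal \<Longrightarrow> a * f \<in> rel_ideal"
  using rel_ideal.mult [of f a 1] by simp

lemma rel_ideal_right: "f \<in> rel_ideal \<Longrightarrow> f * b \<in> rel_ideal"
  using rel_ideal.mult [of f 1 b] by simp

lemma rel_ideal_uminus: "f \<in> rel_ideal \<Longrightarrow> - f \<in> rel_ideal"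
  using rel_ideal_left [of f "- 1"] by simp

lemma rel_ideal_diff: "f \<in> rel_ideal \<Longrightarrow> g \<in> rel_ideal \<Longrightarrow> f - g \<in> rel_ideal"
  using rel_ideal.add [OF _ rel_ideal_uminus, of f g] by simp

quotient_type Aqt = free_alg / "\<lambda>f g. f - g \<in> rel_ideal"
proof (rule equivpI)
  show "reflp (\<lambda>f g. f - g \<in> rel_ideal)"
    by (auto intro!: reflpI rel_ideal.zero)
  show "symp (\<lambda>f g. f - g \<in> rel_ideal)"
    by (rule sympI) (metis minus_diff_eq rel_ideal_uminus)
  show "transp (\<lambda>f g. f - g \<in> rel_ideal)"
  proof (rule transpI)
    fix f g h :: free_alg
    assume "f - g \<in> rel_ideal" "g - h \<in> rel_ideal"
    then have "(f - g) + (g - h) \<in> rel_ideal" by (rule rel_ideal.add)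
    then show "f - h \<in> rel_ideal" by simp
  qed
qed

text \<open>The class \<^class>\<open>ring_1\<close> includes \<open>0 \<noteq> 1\<close>, which is not needed here; the algebra is
  made an instance of \<^class>\<open>ring\<close> and \<^class>\<open>monoid_mult\<close> instead.\<close>

instantiation Aqt :: ring
begin

lift_definition zero_Aqt :: Aqt is 0 .

lift_definition plus_Aqt :: "Aqt \<Rightarrow> Aqt \<Rightarrow> Aqt" is "(+)"
  by (simp add: add_diff_add rel_ideal.add)

lift_definition uminus_Aqt :: "Aqt \<Rightarrow> Aqt" is uminus
  by (metis minus_diff_minus rel_ideal_uminus)

lift_definition minus_Aqt :: "Aqt \<Rightarrow> Aqt \<Rightarrow> Aqt" is "(-)"
proof -
  fix f f' g g' :: free_alg
  assume "f - f' \<in> rel_ideal" "g - g' \<in> rel_ideal"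
  then have "(f - f') - (g - g') \<in> rel_ideal" by (rule rel_ideal_diff)
  then show "(f - g) - (f' - g') \<in> rel_ideal" by (simp add: algebra_simps)
qed

lift_definition times_Aqt :: "Aqt \<Rightarrow> Aqt \<Rightarrow> Aqt" is "(*)"
proof -
  fix f f' g g' :: free_alg
  assume "f - f' \<in> rel_ideal" "g - g' \<in> rel_ideal"
  then have "(f - f') * g + f' * (g - g') \<in> rel_ideal"
    by (intro rel_ideal.add rel_ideal_left rel_ideal_right)
  then show "f * g - f' * g' \<in> rel_ideal" by (simp add: algebra_simps)
qed

instance
  by intro_classes (transfer, simp add: algebra_simps rel_ideal.zero)+

end

instantiation Aqt :: monoid_mult
begin

lift_definition one_Aqt :: Aqt is 1 .

instance
  by intro_classes (transfer, simp add: rel_ideal.zero)+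

end

lift_definition scaleA :: "kfield \<Rightarrow> Aqt \<Rightarrow> Aqt" (infixr "*\<^sub>A" 75) is scaleF
  unfolding scaleF_conv_mult by (metis rel_ideal_left right_diff_distrib)

lift_definition Og :: "gen \<Rightarrow> Aqt" is X .

lemma module_scaleA: "module scaleA"
proof -
  interpret F: module scaleF by (rule module_scaleF)
  show ?thesis
  proof
    fix c d :: kfield and x y :: Aqt
    show "c *\<^sub>A (x + y) = c *\<^sub>A x + c *\<^sub>A y"
      by transfer (simp add: F.scale_right_distrib rel_ideal.zero)
    show "(c + d) *\<^sub>A x = c *\<^sub>A x + d *\<^sub>A x"
      by transfer (simp add: F.scale_left_distrib rel_ideal.zero)
    show "c *\<^sub>A d *\<^sub>A x = (c * d) *\<^sub>A x"
      by transfer (simp add: rel_ideal.zero)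
    show "1 *\<^sub>A x = x"
      by transfer (simp add: rel_ideal.zero)
  qed
qed

lemma scaleA_mult_left: "(c *\<^sub>A x) * y = c *\<^sub>A (x * y)"
  by transfer (simp add: scaleF_mult_left rel_ideal.zero)

lemma scaleA_mult_right: "x * (c *\<^sub>A y) = c *\<^sub>A (x * y)"
  by transfer (simp add: scaleF_mult_right rel_ideal.zero)


section \<open>Automorphisms of the algebra\<close>

definition alg_hom :: "(Aqt \<Rightarrow> Aqt) \<Rightarrow> bool" where
  "alg_hom f \<longleftrightarrow>
     (\<forall>x y. f (x + y) = f x + f y) \<and> (\<forall>x y. f (x * y) = f x * f y) \<and> f 1 = 1 \<and>
     (\<forall>c x. f (c *\<^sub>A x) = c *\<^sub>A f x)"

definition Aut_A :: "(Aqt \<Rightarrow> Aqt) monoid" where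
  "Aut_A = \<lparr>carrier = {f. bij f \<and> alg_hom f}, monoid.mult = (\<circ>), one = id\<rparr>"

lemma group_Aut_A: "group Aut_A"
proof (rule groupI)
  fix f assume "f \<in> carrier Aut_A"
  then have f: "bij f" "alg_hom f" by (simp_all add: Aut_A_def)
  define g where "g = inv_into UNIV f"
  have g: "bij g" "g \<circ> f = id"
    using f(1) by (simp_all add: g_def bij_imp_bij_inv bij_is_inj)
  have cancel: "g (f x) = x" "f (g x) = x" for x
    using f(1) by (simp_all add: g_def bij_is_inj bij_is_surj surj_f_inv_f)
  have "g (x + y) = g x + g y" "g (x * y) = g x * g y" "g 1 = 1"
    "g (c *\<^sub>A x) = c *\<^sub>A g x" for x y c
    using f(2) cancel unfolding alg_hom_def by metis+
  then have "alg_hom g" by (simp add: alg_hom_def)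
  then show "\<exists>g \<in> carrier Aut_A. g \<otimes>\<^bsub>Aut_A\<^esub> f = \<one>\<^bsub>Aut_A\<^esub>"
    using g by (intro bexI [of _ g]) (simp_all add: Aut_A_def)
qed (auto simp: Aut_A_def alg_hom_def bij_comp comp_assoc)

fun I_gen :: "gen \<Rightarrow> Aqt" where
  "I_gen O1 = Og O2" | "I_gen O2 = Og O3" | "I_gen O3 = Og O4"
| "I_gen O4 = Og O5" | "I_gen O5 = Og O6" | "I_gen O6 = Og O1"
| "I_gen O12 = Og O23" | "I_gen O23 = Og O34" | "I_gen O34 = Og O45"
| "I_gen O45 = Og O56" | "I_gen O56 = Og O61" | "I_gen O61 = Og O12"
| "I_gen O123 = Og O234" | "I_gen O234 = Og O345" | "I_gen O345 = Og O123"

fun d1_gen :: "gen \<Rightarrow> Aqt" where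
  "d1_gen O2 = qp 1 *\<^sub>A (Og O1 * Og O2) - qp 2 *\<^sub>A Og O12"
| "d1_gen O6 = Og O61"
| "d1_gen O12 = Og O2"
| "d1_gen O23 = qp 1 *\<^sub>A (Og O1 * Og O23) - qp 2 *\<^sub>A Og O123"
| "d1_gen O56 = Og O234"
| "d1_gen O61 = qp 1 *\<^sub>A (Og O1 * Og O61) - qp 2 *\<^sub>A Og O6"
| "d1_gen O123 = Og O23"
| "d1_gen O234 = qp 1 *\<^sub>A (Og O1 * Og O234) - qp 2 *\<^sub>A Og O56"
| "d1_gen g = Og g"


section \<open>The mapping class group of the closed genus two surface\<close>

text \<open>The group is given by its presentation on the Dehn twists along a chain of five curves.
  In a word, \<open>(d, True)\<close> is the letter \<open>d\<close> and \<open>(d, False)\<close> its formal inverse.\<close>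

datatype dehn = D1 | D2 | D3 | D4 | D5

type_synonym mword = "(dehn \<times> bool) list"

definition tw :: "nat \<Rightarrow> mword"
  where "tw i = [([D1, D2, D3, D4, D5] ! (i - 1), True)]"

definition wI :: mword where "wI = tw 1 @ tw 2 @ tw 3 @ tw 4 @ tw 5"

definition wH :: mword
  where "wH = tw 1 @ tw 2 @ tw 3 @ tw 4 @ tw 5 @ tw 5 @ tw 4 @ tw 3 @ tw 2 @ tw 1"

inductive mod_rel :: "mword \<Rightarrow> mword \<Rightarrow> bool" where
  braid: "1 \<le> i \<Longrightarrow> i \<le> 4 \<Longrightarrow>
    mod_rel (tw i @ tw (i+1) @ tw i) (tw (i+1) @ tw i @ tw (i+1))"
| commute: "i \<in> {1..5} \<Longrightarrow> j \<in> {1..5} \<Longrightarrow> \<bar>int i - int j\<bar> > 1 \<Longrightarrow>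
    mod_rel (tw i @ tw j) (tw j @ tw i)"
| I_order: "mod_rel (wI @ wI @ wI @ wI @ wI @ wI) []"
| H_order: "mod_rel (wH @ wH) []"
| H_central: "i \<in> {1..5} \<Longrightarrow> mod_rel (wH @ tw i) (tw i @ wH)"

inductive mod_eq :: "mword \<Rightarrow> mword \<Rightarrow> bool" where
  rel: "mod_rel u v \<Longrightarrow> mod_eq u v"
| cancel: "mod_eq [(d, b), (d, \<not> b)] []"
| refl: "mod_eq u u"
| sym: "mod_eq u v \<Longrightarrow> mod_eq v u"
| trans: "mod_eq u v \<Longrightarrow> mod_eq v w \<Longrightarrow> mod_eq u w"
| append: "mod_eq u u' \<Longrightarrow> mod_eq v v' \<Longrightarrow> mod_eq (u @ v) (u' @ v')"

quotient_type mclass = mword / mod_eq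
  by (rule equivpI) (auto intro!: reflpI sympI transpI intro: mod_eq.refl mod_eq.sym mod_eq.trans)

lift_definition mclass_mult :: "mclass \<Rightarrow> mclass \<Rightarrow> mclass" is "(@)"
  by (rule mod_eq.append)

lift_definition mclass_one :: mclass is "[]" .

lift_definition dehn_twist :: "nat \<Rightarrow> mclass" is tw .

definition Mod_Sigma2 :: "mclass monoid" where
  "Mod_Sigma2 = \<lparr>carrier = UNIV, monoid.mult = mclass_mult, one = mclass_one\<rparr>"

lemma mod_eq_inverse: "mod_eq (rev (map (\<lambda>(d, b). (d, \<not> b)) w) @ w) []"
proof (induction w)
  case Nil
  then show ?case by (simp add: mod_eq.refl)
next
  case (Cons l w)
  obtain d b where l: "l = (d, b)" by force
  let ?r = "rev (map (\<lambda>(d, b). (d, \<not> b)) w)"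
  have "mod_eq [(d, \<not> b), (d, b)] []"
    using mod_eq.cancel [of d "\<not> b"] by simp
  then have "mod_eq (?r @ ([(d, \<not> b), (d, b)] @ w)) (?r @ ([] @ w))"
    by (intro mod_eq.append mod_eq.refl)
  then show ?case
    using Cons l by (auto intro: mod_eq.trans)
qed

lemma group_Mod_Sigma2: "group Mod_Sigma2"
proof (rule groupI)
  fix x assume "x \<in> carrier Mod_Sigma2"
  have "\<exists>y. mclass_mult y x = mclass_one"
    by transfer (blast intro: mod_eq_inverse)
  then show "\<exists>y \<in> carrier Mod_Sigma2. y \<otimes>\<^bsub>Mod_Sigma2\<^esub> x = \<one>\<^bsub>Mod_Sigma2\<^esub>"
    by (simp add: Mod_Sigma2_def)
qed (simp_all add: Mod_Sigma2_def, (transfer, simp add: mod_eq.refl)+)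

end

theory Submission
  imports Defs
begin

text \<open>Write \<open>[a, b]\<close> for the commutator \<open>[a, b]\<^sub>q\<close>, \<open>\<delta>\<close> for its denominator \<open>q\<^sup>1\<^sup>/\<^sup>2 - q\<^sup>-\<^sup>1\<^sup>/\<^sup>2\<close> and \<open>x\<close> for \<open>O\<^sub>1\<close>. There
are three things to see: the two maps on generators respect the relations, the resulting
endomorphisms satisfy the relations of the mapping class group, and they are invertible.

\<^emph>\<open>The rotation is well defined.\<close> It permutes the relations, except that \<open>R6a\<close>, \<open>R6b\<close>, \<open>R6c\<close> cover only
three of the six indices, so one needs that their right-hand sides do not change under \<open>i \<mapsto> i + 3\<close>. This comes
down to the identity \<open>O\<^sub>1O\<^sub>6O\<^sub>5 - O\<^sub>5O\<^sub>6O\<^sub>1 = O\<^sub>4O\<^sub>3O\<^sub>2 - O\<^sub>2O\<^sub>3O\<^sub>4\<close> (\<open>antipodal_triples\<close>). To prove it,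
\<open>[O\<^sub>3\<^sub>4\<^sub>5, O\<^sub>1\<^sub>2\<^sub>3]\<close> (with \<open>q\<^sup>2\<close>) is expanded after writing the arguments as \<open>[O\<^sub>3\<^sub>4, O\<^sub>5]\<close> and \<open>[O\<^sub>1, O\<^sub>2\<^sub>3]\<close>. By
\<open>R4a\<close> the inner part yields a term \<open>\<theta> O\<^sub>6\<close>, framed by \<open>O\<^sub>1\<close> and \<open>O\<^sub>5\<close>. The left-hand side has an
antipodal description, which yields \<open>\<theta> O\<^sub>3\<close>, framed by \<open>O\<^sub>4\<close> and \<open>O\<^sub>2\<close>, and the two must agree.

\<^emph>\<open>The twist is well defined.\<close> The generators that commute with \<open>x\<close> are fixed by \<open>d\<^sub>1\<close>. The other eight
satisfy \<open>d\<^sub>1 a = [a, x]\<close> and \<open>a = [x, d\<^sub>1 a]\<close>; call \<open>(a, d\<^sub>1 a)\<close> a doublet. These two equations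
make \<open>d\<^sub>1\<close> on short words an operator built from left and right multiplication by \<open>x\<close> alone: on words
with one noncommuting letter it is \<open>m \<mapsto> [m, x]\<close>, and on words with none or two of them it is
\<open>m \<mapsto> m + (q\<^sup>1\<^sup>/\<^sup>2 m x x - (q\<^sup>1\<^sup>/\<^sup>2 + q\<^sup>-\<^sup>1\<^sup>/\<^sup>2) x m x + q\<^sup>-\<^sup>1\<^sup>/\<^sup>2 x x m) / (\<delta>\<^sup>2 (q\<^sup>1\<^sup>/\<^sup>2 + q\<^sup>-\<^sup>1\<^sup>/\<^sup>2))\<close> (\<open>twist_product\<close>).
In every defining relation, the \<open>q\<close>-Casimir included, all terms are of the first kind or all are of the
second kind. So in either case the image of a relation under \<open>d\<^sub>1\<close> is obtained by applying one linear
operator to both of its sides, and therefore holds (\<open>homogeneous_twisted\<close>).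

\<^emph>\<open>The relations of the group.\<close> The algebra is generated by any five consecutive \<open>O\<^sub>i\<close>
(\<open>alg_hom_eqI_o1\<close>), and \<open>d\<^sub>k\<close> sends the two neighbours \<open>O\<^sub>k\<^sub>\<plusminus>\<^sub>1\<close> to \<open>[O\<^sub>k\<^sub>\<plusminus>\<^sub>1, O\<^sub>k]\<close> and fixes the other
four. Braid and commutation relations become identities between nested commutators, and in the same
way \<open>d\<^sub>5d\<^sub>4d\<^sub>3d\<^sub>2d\<^sub>1 = I\<^sup>-\<^sup>1\<close> and \<open>d\<^sub>1d\<^sub>2d\<^sub>3d\<^sub>4d\<^sub>5 = I\<close>; only the latter uses \<open>antipodal_triples\<close>. The former makes
\<open>d\<^sub>1\<close> injective and \<open>d\<^sub>5\<close> surjective, hence both bijective as they are conjugate. Multiplying the two,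
the hyperelliptic involution \<open>H\<close> acts as the identity, so its relations hold trivially.\<close>


section \<open>Scalars\<close>

lemma q_root_nonzero: "q_root \<noteq> 0"
  by (simp add: q_root_def Zero_fract_def eq_fract)

lemma t_root_nonzero: "t_root \<noteq> 0"
  by (simp add: t_root_def Zero_fract_def eq_fract)

lemma qp_0: "qp 0 = 1"
  by (simp add: qp_def)

lemma qp_nonzero: "qp i \<noteq> 0"
  by (simp add: qp_def q_root_nonzero)

lemma qp_mult: "qp i * qp j = qp (i + j)"
  by (simp add: qp_def q_root_nonzero power_int_add)

lemma qp_mult_left: "qp i * (qp j * c) = qp (i + j) * c"
  by (simp flip: mult.assoc qp_mult)

lemma Fract_power: "Fract a 1 ^ n = Fract (a ^ n) 1" for a :: "'a::idom"
  by (induction n) (simp_all add: One_fract_def)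

lemma Fract_1_eq_iff: "Fract a 1 = Fract b 1 \<longleftrightarrow> a = b" for a b :: "'a::idom"
  by (simp add: eq_fract)

text \<open>Nonnegative powers of \<open>q\<^sup>1\<^sup>/\<^sup>4\<close> are polynomials, so that inequalities between scalars can be read off
from coefficients.\<close>

lemma qp_eq_Fract: "qp (int n) = Fract [:[:0, 1:] ^ n:] 1"
  by (simp add: qp_def q_root_def Fract_power poly_const_pow)

abbreviation \<delta> :: kfield where "\<delta> \<equiv> qp 2 - qp (- 2)"

lemma qp_2_diff_nonzero: "qp 2 - qp (- 2) \<noteq> 0"
proof
  assume "qp 2 - qp (- 2) = 0"
  then have "qp 2 * (qp 2 - qp (- 2)) = 0" by simp
  then have "qp (int 4) = 1" by (simp add: right_diff_distrib qp_mult qp_0)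
  then show False
    by (simp only: qp_eq_Fract One_fract_def Fract_1_eq_iff)
       (simp add: numeral_eq_Suc one_pCons)
qed

lemma qp_2_sum_nonzero: "qp 2 + qp (- 2) \<noteq> 0"
proof
  assume "qp 2 + qp (- 2) = 0"
  then have "qp 2 * (qp 2 + qp (- 2)) = 0" by simp
  then have "qp (int 4) = - 1" by (simp add: distrib_left qp_mult qp_0 eq_neg_iff_add_eq_0)
  then show False
    by (simp only: qp_eq_Fract One_fract_def Fract_1_eq_iff minus_fract)
       (simp add: numeral_eq_Suc one_pCons)
qed

lemma theta_nonzero: "\<theta> \<noteq> 0"
proof -
  have "tp (int 4) = Fract ([:0, 1:] ^ 4) 1"
    by (simp only: tp_def t_root_def power_int_of_nat Fract_power)
  then have "q + t = Fract ([:[:0, 1:] ^ 4:] + [:0, 1:] ^ 4) 1"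
    using qp_eq_Fract [of 4] by simp
  also have "\<dots> \<noteq> 0"
    by (simp add: Zero_fract_def eq_fract numeral_eq_Suc)
  finally show ?thesis
    by (simp add: \<theta>_def qp_nonzero tp_def t_root_nonzero)
qed


section \<open>Homomorphisms out of the algebra\<close>

interpretation F: module scaleF by (rule module_scaleF)

interpretation A: module scaleA by (rule module_scaleA)

text \<open>Identities in the algebra are proved after clearing denominators, so that all coefficients are Laurent
polynomials and terms cancel syntactically. This is the step back.\<close>

lemma scaleA_cancel:
  assumes "c \<noteq> 0" and "c *\<^sub>A a = c *\<^sub>A b"
  shows "a = b"
proof -
  have "(1 / c) *\<^sub>A (c *\<^sub>A a) = (1 / c) *\<^sub>A (c *\<^sub>A b)"
    by (simp only: assms(2))
  with \<open>c \<noteq> 0\<close> show ?thesis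
    by simp
qed

text \<open>Words are built letter by letter from the left, so multiplicativity needs to be considered for a
generator on the left only.\<close>

lemma free_alg_induct [case_names zero add scale one gen]:
  assumes "P 0" and "\<And>f g. P f \<Longrightarrow> P g \<Longrightarrow> P (f + g)" and "\<And>c f. P f \<Longrightarrow> P (c *\<^sub>F f)"
    and "P 1" and "\<And>g f. P f \<Longrightarrow> P (X g * f)"
  shows "P f"
proof -
  have word: "P (Poly_Mapping.single (NC w) 1)" for w
  proof (induction w)
    case Nil
    with \<open>P 1\<close> show ?case
      by (simp flip: zero_nc_monomial_def)
  next
    case (Cons g w)
    have "Poly_Mapping.single (NC (g # w)) 1 = X g * Poly_Mapping.single (NC w) 1"
      by (simp add: X_def mult_single plus_nc_monomial_def)
    with Cons assms(5) show ?case
      by simp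
  qed
  have single: "P (Poly_Mapping.single k c)" for k c
  proof -
    have "Poly_Mapping.single k c = c *\<^sub>F Poly_Mapping.single (NC (letters k)) 1"
      by (simp add: scaleF_conv_mult mult_single)
    with word assms(3) show ?thesis
      by metis
  qed
  show ?thesis
  proof (induction f rule: update_induct)
    case (update f k v)
    then have "Poly_Mapping.lookup f k = 0"
      by (simp add: in_keys_iff)
    then have "Poly_Mapping.update k v f = f + Poly_Mapping.single k v"
      by (intro poly_mapping_eqI) (auto simp: lookup_update lookup_add lookup_single when_def)
    with update single assms(2) show ?case
      by simp
  qed (fact assms(1))
qed

definition extend :: "(gen \<Rightarrow> Aqt) \<Rightarrow> free_alg \<Rightarrow> Aqt" where
  "extend \<phi> f = (\<Sum>k\<in>Poly_Mapping.keys f. Poly_Mapping.lookup f k *\<^sub>A prod_list (map \<phi> (letters k)))"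

lemma extend_superset:
  assumes "finite S" and "Poly_Mapping.keys f \<subseteq> S"
  shows "extend \<phi> f = (\<Sum>k\<in>S. Poly_Mapping.lookup f k *\<^sub>A prod_list (map \<phi> (letters k)))"
  unfolding extend_def using assms
  by (intro sum.mono_neutral_left) (auto simp: in_keys_iff)

lemma extend_add: "extend \<phi> (f + g) = extend \<phi> f + extend \<phi> g"
proof -
  let ?S = "Poly_Mapping.keys f \<union> Poly_Mapping.keys g"
  have "Poly_Mapping.keys (f + g) \<subseteq> ?S"
    by (rule Poly_Mapping.keys_add)
  then show ?thesis
    by (simp add: extend_superset [of ?S] lookup_add A.scale_left_distrib sum.distrib)
qed

lemma extend_0: "extend \<phi> 0 = 0"
  by (simp add: extend_def)

lemma extend_single: "extend \<phi> (Poly_Mapping.single k c) = c *\<^sub>A prod_list (map \<phi> (letters k))"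
  by (subst extend_superset [of "{k}"]) auto

lemma extend_scale: "extend \<phi> (c *\<^sub>F f) = c *\<^sub>A extend \<phi> f"
proof -
  have "Poly_Mapping.keys (c *\<^sub>F f) \<subseteq> Poly_Mapping.keys f"
    by (auto simp: scaleF_def in_keys_iff Poly_Mapping.map.rep_eq)
  then show ?thesis
    by (subst extend_superset [of "Poly_Mapping.keys f"])
       (auto simp: extend_def scaleF_def Poly_Mapping.map.rep_eq when_def in_keys_iff
         A.scale_sum_right intro!: sum.cong)
qed

lemma extend_X: "extend \<phi> (X g) = \<phi> g"
  by (simp add: X_def extend_single)

lemma extend_1: "extend \<phi> 1 = 1"
  using extend_single [of \<phi> 0 1] by (simp, simp add: zero_nc_monomial_def)

lemma extend_X_mult: "extend \<phi> (X g * f) = \<phi> g * extend \<phi> f"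
proof (induction f rule: update_induct)
  case (update f k v)
  then have "Poly_Mapping.lookup f k = 0"
    by (simp add: in_keys_iff)
  then have *: "Poly_Mapping.update k v f = f + Poly_Mapping.single k v"
    by (intro poly_mapping_eqI) (auto simp: lookup_update lookup_add lookup_single when_def)
  have "extend \<phi> (X g * Poly_Mapping.single k v) = \<phi> g * extend \<phi> (Poly_Mapping.single k v)"
    by (simp add: X_def mult_single extend_single plus_nc_monomial_def scaleA_mult_right)
  with update show ?case
    by (simp add: * distrib_left extend_add)
qed (simp add: extend_0)

lemma extend_mult: "extend \<phi> (f * g) = extend \<phi> f * extend \<phi> g"
  by (induction f rule: free_alg_induct)
     (simp_all add: extend_0 extend_1 extend_add extend_scale extend_X_mult distrib_right
       scaleF_mult_left scaleA_mult_left mult.assoc)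

lemma extend_minus: "extend \<phi> (- f) = - extend \<phi> f"
  by (metis add.right_inverse extend_0 extend_add minus_unique)

lemma extend_diff: "extend \<phi> (f - g) = extend \<phi> f - extend \<phi> g"
  by (metis diff_conv_add_uminus extend_add extend_minus)

lemmas extend_simps = extend_0 extend_1 extend_add extend_minus extend_diff extend_scale
  extend_mult extend_X

lemma extend_Og: "extend Og f = abs_Aqt f"
  by (induction f rule: free_alg_induct)
     (simp_all add: extend_simps Og.abs_eq zero_Aqt.abs_eq one_Aqt.abs_eq plus_Aqt.abs_eq
       times_Aqt.abs_eq scaleA.abs_eq)

lemma relation_holds: "f \<doteq> g \<Longrightarrow> extend Og f = extend Og g"
  by (simp add: extend_Og Aqt.abs_eq_iff rel_ideal.rel)

definition satisfies_relations :: "(gen \<Rightarrow> Aqt) \<Rightarrow> bool" where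
  "satisfies_relations \<phi> \<longleftrightarrow> (\<forall>f g. f \<doteq> g \<longrightarrow> extend \<phi> f = extend \<phi> g)"

definition induced :: "(gen \<Rightarrow> Aqt) \<Rightarrow> Aqt \<Rightarrow> Aqt" where
  "induced \<phi> a = extend \<phi> (rep_Aqt a)"

lemma extend_rel_ideal: "f \<in> rel_ideal \<Longrightarrow> satisfies_relations \<phi> \<Longrightarrow> extend \<phi> f = 0"
proof (induction rule: rel_ideal.induct)
  case (rel f g)
  then have "extend \<phi> f = extend \<phi> g"
    unfolding satisfies_relations_def by blast
  then show ?case
    by (simp add: extend_diff)
qed (simp_all add: extend_simps)

lemma induced_extend_Og:
  assumes "satisfies_relations \<phi>"
  shows "induced \<phi> (extend Og f) = extend \<phi> f"
proof -
  have "rep_Aqt (abs_Aqt f) - f \<in> rel_ideal"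
    by (rule Aqt.abs_eq_iff [THEN iffD1]) (rule Quotient3_abs_rep [OF Quotient3_Aqt])
  from extend_rel_ideal [OF this assms] show ?thesis
    by (simp add: induced_def extend_Og extend_diff)
qed

lemma Aqt_cases: obtains f where "a = extend Og f"
  by (rule that [of "rep_Aqt a"]) (simp add: extend_Og Quotient3_abs_rep [OF Quotient3_Aqt])

lemma induced_Og: "satisfies_relations \<phi> \<Longrightarrow> induced \<phi> (Og g) = \<phi> g"
  using induced_extend_Og [of \<phi> "X g"] by (simp add: extend_X)

lemma alg_hom_induced:
  assumes "satisfies_relations \<phi>"
  shows "alg_hom (induced \<phi>)"
proof -
  note ind = induced_extend_Og [OF assms]
  have "induced \<phi> (a + b) = induced \<phi> a + induced \<phi> b"
    and "induced \<phi> (a * b) = induced \<phi> a * induced \<phi> b" for a b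
  proof -
    obtain f g where "a = extend Og f" "b = extend Og g"
      by (meson Aqt_cases)
    then show "induced \<phi> (a + b) = induced \<phi> a + induced \<phi> b"
      and "induced \<phi> (a * b) = induced \<phi> a * induced \<phi> b"
      using ind [of "f + g"] ind [of "f * g"] by (simp_all add: ind extend_simps)
  qed
  moreover have "induced \<phi> 1 = 1"
    using ind [of 1] by (simp add: extend_1)
  moreover have "induced \<phi> (c *\<^sub>A a) = c *\<^sub>A induced \<phi> a" for c a
  proof -
    obtain f where "a = extend Og f"
      by (rule Aqt_cases)
    then show ?thesis
      using ind [of "c *\<^sub>F f"] by (simp add: ind extend_simps)
  qed
  ultimately show ?thesis
    by (simp add: alg_hom_def)
qed

lemma
  assumes "alg_hom h"
  shows alg_hom_add: "h (a + b) = h a + h b"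
    and alg_hom_mult: "h (a * b) = h a * h b"
    and alg_hom_1: "h 1 = 1"
    and alg_hom_scale: "h (c *\<^sub>A a) = c *\<^sub>A h a"
    and alg_hom_diff: "h (a - b) = h a - h b"
proof -
  show *: "h (a + b) = h a + h b" "h (a * b) = h a * h b" "h 1 = 1" "h (c *\<^sub>A a) = c *\<^sub>A h a" for a b c
    using assms by (simp_all add: alg_hom_def)
  show "h (a - b) = h a - h b"
    using *(1) [of "a - b" b] by (metis add_diff_cancel_right' diff_add_cancel)
qed

lemma alg_hom_comp: "alg_hom g \<Longrightarrow> alg_hom h \<Longrightarrow> alg_hom (g \<circ> h)"
  by (simp add: alg_hom_def)

lemma alg_hom_id: "alg_hom id"
  by (simp add: alg_hom_def)

lemma alg_hom_eqI:
  assumes "alg_hom h" and "alg_hom h'" and gen: "\<And>g. h (Og g) = h' (Og g)"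
  shows "h = h'"
proof
  fix a
  obtain f where a: "a = extend Og f"
    by (rule Aqt_cases)
  note hom = assms(1,2)[THEN alg_hom_add] assms(1,2)[THEN alg_hom_mult] assms(1,2)[THEN alg_hom_1]
    assms(1,2)[THEN alg_hom_scale]
  have "h 0 = h' 0"
    by (metis A.scale_zero_left hom(7,8))
  then show "h a = h' a"
    unfolding a
    by (induction f rule: free_alg_induct) (simp_all add: extend_simps hom gen)
qed


section \<open>Commutators\<close>

definition br :: "int \<Rightarrow> Aqt \<Rightarrow> Aqt \<Rightarrow> Aqt" where
  "br j a b = (1 / \<delta>) *\<^sub>A (qp j *\<^sub>A (a * b) - qp (-j) *\<^sub>A (b * a))"

lemma extend_qbr: "extend \<phi> (qbr j f g) = br j (extend \<phi> f) (extend \<phi> g)"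
  by (simp add: qbr_def br_def extend_simps)

lemma alg_hom_br: "alg_hom h \<Longrightarrow> h (br j a b) = br j (h a) (h b)"
  by (simp add: br_def alg_hom_scale alg_hom_diff alg_hom_mult)

lemma br_eq_iff:
  "br j a b = c \<longleftrightarrow> qp j *\<^sub>A (a * b) - qp (-j) *\<^sub>A (b * a) = qp 2 *\<^sub>A c - qp (-2) *\<^sub>A c"
proof -
  have "br j a b = c \<longleftrightarrow> \<delta> *\<^sub>A br j a b = \<delta> *\<^sub>A c"
    using scaleA_cancel [OF qp_2_diff_nonzero] by blast
  then show ?thesis
    using qp_2_diff_nonzero by (simp add: br_def A.scale_left_diff_distrib)
qed

lemma br_scaled: "\<delta> *\<^sub>A br j a b = qp j *\<^sub>A (a * b) - qp (-j) *\<^sub>A (b * a)"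
  using qp_2_diff_nonzero by (simp add: br_def)

text \<open>Distributes everything and collects powers of \<open>q\<^sup>1\<^sup>/\<^sup>4\<close>. On terms without denominators this is a normal
form: a sum of words, each with a coefficient \<open>\<plusminus>qp j\<close>.\<close>

lemmas expand = A.scale_right_distrib A.scale_left_distrib A.scale_right_diff_distrib
  A.scale_left_diff_distrib scaleA_mult_left scaleA_mult_right distrib_left distrib_right
  left_diff_distrib right_diff_distrib mult.assoc qp_mult qp_mult_left qp_0

lemma br_linear:
  "br j (a + b) c = br j a c + br j b c" "br j c (a + b) = br j c a + br j c b"
  "br j (r *\<^sub>A a) c = r *\<^sub>A br j a c" "br j c (r *\<^sub>A a) = r *\<^sub>A br j c a"
  by (simp_all add: br_def algebra_simps scaleA_mult_left scaleA_mult_right)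

lemma br_commute:
  assumes "m * x = x * m"
  shows "br j (m * a) x = m * br j a x" and "br j (a * m) x = br j a x * m"
    and "br j x (m * a) = m * br j x a" and "br j x (a * m) = br j x a * m"
proof -
  have "m * (x * b) = x * (m * b)" for b
    by (simp add: assms flip: mult.assoc)
  then show "br j (m * a) x = m * br j a x" and "br j (a * m) x = br j a x * m"
    and "br j x (m * a) = m * br j x a" and "br j x (a * m) = br j x a * m"
    by (simp_all add: br_def algebra_simps scaleA_mult_left scaleA_mult_right assms)
qed

text \<open>Both sides are \<open>\<delta>\<^sup>-\<^sup>2 (q\<^sup>1\<^sup>/\<^sup>2 x a x - a x x - x x a + q\<^sup>-\<^sup>1\<^sup>/\<^sup>2 x a x)\<close>. Hence the relations
\<open>[x, [a, x]] = a\<close> and \<open>[[x, a], x] = a\<close> are equivalent.\<close>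

lemma br_flip: "br 1 (br 1 x a) x = br 1 x (br 1 a x)"
  by (simp add: br_def expand)

lemma br_assoc: "a * c = c * a \<Longrightarrow> br 1 a (br 1 b c) = br 1 (br 1 a b) c"
proof -
  assume c: "a * c = c * a"
  then have "a * (c * m) = c * (a * m)" for m
    by (simp flip: mult.assoc)
  with c show ?thesis
    by (simp add: br_def expand)
qed

lemma br_right_commute: "a * c = c * a \<Longrightarrow> br 1 (br 1 b a) c = br 1 (br 1 b c) a"
proof -
  assume c: "a * c = c * a"
  then have "a * (c * m) = c * (a * m)" for m
    by (simp flip: mult.assoc)
  with c show ?thesis
    by (simp add: br_def expand)
qed

lemma br_br_scaled:
  "(\<delta> * \<delta>) *\<^sub>A br 1 (br 1 a b) c
   = qp 2 *\<^sub>A (a * b * c) - b * a * c - c * a * b + qp (-2) *\<^sub>A (c * b * a)"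
proof -
  have "(\<delta> * \<delta>) *\<^sub>A br 1 (br 1 a b) c
    = \<delta> *\<^sub>A \<delta> *\<^sub>A br 1 (br 1 a b) c"
    by simp
  also have "\<dots> = qp 1 *\<^sub>A ((\<delta> *\<^sub>A br 1 a b) * c)
      - qp (-1) *\<^sub>A (c * (\<delta> *\<^sub>A br 1 a b))"
    unfolding br_scaled [of 1 "br 1 a b" c] scaleA_mult_left scaleA_mult_right
      A.scale_right_diff_distrib A.scale_scale by (simp only: mult_ac)
  also have "\<dots> = qp 2 *\<^sub>A (a * b * c) - b * a * c - c * a * b + qp (-2) *\<^sub>A (c * b * a)"
    unfolding br_scaled by (simp add: expand)
  finally show ?thesis .
qed


section \<open>The relations with a cyclic index\<close>

definition o1 :: "int \<Rightarrow> Aqt" where "o1 i = extend Og (A1 i)"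

definition o2 :: "int \<Rightarrow> Aqt" where "o2 i = extend Og (A2 i)"

definition o3 :: "int \<Rightarrow> Aqt" where "o3 i = extend Og (A3 i)"

lemma Og_eq:
  "Og O1 = o1 1" "Og O2 = o1 2" "Og O3 = o1 3" "Og O4 = o1 4" "Og O5 = o1 5" "Og O6 = o1 6"
  "Og O12 = o2 1" "Og O23 = o2 2" "Og O34 = o2 3" "Og O45 = o2 4" "Og O56 = o2 5" "Og O61 = o2 6"
  "Og O123 = o3 1" "Og O234 = o3 2" "Og O345 = o3 3"
  by (simp_all add: o1_def o2_def o3_def A1_def A2_def A3_def extend_X)

lemma o_periodic: "o1 (i + 6) = o1 i" "o2 (i + 6) = o2 i" "o3 (i + 3) = o3 i"
proof -
  have "(i + 6 - 1) mod 6 = (i - 1) mod 6" "(i + 3 - 1) mod 3 = (i - 1) mod 3"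
    using mod_add_self2 [of "i - 1" 6] mod_add_self2 [of "i - 1" 3] by (simp_all add: algebra_simps)
  then show "o1 (i + 6) = o1 i" "o2 (i + 6) = o2 i" "o3 (i + 3) = o3 i"
    by (simp_all only: o1_def o2_def o3_def A1_def A2_def A3_def)
qed

lemma o1_cong: "i mod 6 = j mod 6 \<Longrightarrow> o1 i = o1 j"
  unfolding o1_def A1_def using mod_diff_cong [of i 6 j 1 1] by simp

lemma
  shows br_o1_o1: "br 1 (o1 i) (o1 (i+1)) = o2 i"
    and br_o2_o1: "br 1 (o2 i) (o1 i) = o1 (i+1)"
    and br_o1_o2: "br 1 (o1 (i+1)) (o2 i) = o1 i"
    and br_o2_o1_next: "br 1 (o2 i) (o1 (i+2)) = o3 i"
    and br_o1_o2_prev: "br 1 (o1 (i-1)) (o2 i) = o3 (i-1)"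
    and o2_o1_commute_3: "o2 i * o1 (i+3) = o1 (i+3) * o2 i"
    and o2_o1_commute_4: "o2 i * o1 (i+4) = o1 (i+4) * o2 i"
    and br_o3_o1: "br 1 (o3 i) (o1 i) = o2 (i+1)"
    and br_o1_o3: "br 1 (o1 (i+2)) (o3 i) = o2 i"
    and o3_o1_commute: "o3 i * o1 (i+1) = o1 (i+1) * o3 i"
    and br_o2_o2_overlap: "br 2 (o2 (i+1)) (o2 i)
        = (qp (-2) * (q + 1)) *\<^sub>A (o1 i * o1 (i+2)) - \<theta> *\<^sub>A o1 (i+4)"
    and br_o2_o2: "br 1 (o2 i) (o2 (i+2)) = o2 (i+4)"
    and o2_o2_commute: "o2 i * o2 (i+3) = o2 (i+3) * o2 i"
    and br_o3_o2: "br 1 (o3 i) (o2 i) = o1 (i+2)"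
    and br_o2_o3: "br 1 (o2 (i+1)) (o3 i) = o1 i"
    and br_o3_o2_skew: "br 0 (o3 i) (o2 (i+2)) = o1 (i+2) * o2 (i+4) - o1 (i+3) * o2 i"
  using defrel.intros[THEN relation_holds]
  by (simp_all only: extend_qbr extend_simps o1_def o2_def o3_def)

lemmas relations = br_o1_o1 br_o2_o1 br_o1_o2 br_o2_o1_next br_o1_o2_prev o2_o1_commute_3 o2_o1_commute_4 br_o3_o1 
  br_o1_o3 o3_o1_commute br_o2_o2_overlap br_o2_o2 o2_o2_commute br_o3_o2 br_o2_o3 br_o3_o2_skew

lemma o1_commute: "(i - j) mod 6 \<notin> {0, 1, 5} \<Longrightarrow> o1 i * o1 j = o1 j * o1 i"
  using R1b[THEN relation_holds] by (simp only: extend_simps o1_def)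

text \<open>Neighbours \<open>a, b\<close> satisfy the quadratic relations of a doublet in both orders, and with both
orientations of the inner commutator.\<close>

lemma br_adjacent:
  "br 1 (o1 (i+1)) (br 1 (o1 i) (o1 (i+1))) = o1 i"
  "br 1 (br 1 (o1 i) (o1 (i+1))) (o1 i) = o1 (i+1)"
  "br 1 (o1 i) (br 1 (o1 (i+1)) (o1 i)) = o1 (i+1)"
  "br 1 (br 1 (o1 (i+1)) (o1 i)) (o1 (i+1)) = o1 i"
proof -
  show *: "br 1 (o1 (i+1)) (br 1 (o1 i) (o1 (i+1))) = o1 i"
    "br 1 (br 1 (o1 i) (o1 (i+1))) (o1 i) = o1 (i+1)"
    by (simp_all add: br_o1_o1 br_o2_o1 br_o1_o2)
  show "br 1 (o1 i) (br 1 (o1 (i+1)) (o1 i)) = o1 (i+1)"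
    "br 1 (br 1 (o1 (i+1)) (o1 i)) (o1 (i+1)) = o1 i"
    using * by (simp_all only: br_flip)
qed


section \<open>Antipodal symmetry\<close>

text \<open>Four products of \<open>x\<close>, \<open>m\<close>, \<open>y\<close> with the signs and powers of \<open>\<delta>\<^sup>2 [[x, m], y]\<close>. If \<open>m = a b\<close>, where \<open>x\<close>
commutes with \<open>a\<close> and \<open>y\<close> with \<open>b\<close> and with \<open>x\<close>, then it is the expansion of \<open>\<delta>\<^sup>2 [a, y] [x, b]\<close>.\<close>

definition sandwich :: "Aqt \<Rightarrow> Aqt \<Rightarrow> Aqt \<Rightarrow> Aqt" where
  "sandwich x y m = qp 2 *\<^sub>A (x * m * y) - x * y * m - m * x * y + qp (-2) *\<^sub>A (y * m * x)"

text \<open>Since \<open>a\<close> commutes with \<open>x\<close>, and \<open>b\<close> with \<open>y\<close>, the outer letters can be moved past the inner ones in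
each of the four terms, and the two orders of multiplication give the same frame around
\<open>a b\<close> and \<open>b a\<close>.\<close>

lemma br_mult_br:
  assumes "x * y = y * x" and "x * a = a * x" and "b * y = y * b"
  shows "(\<delta> * \<delta>) *\<^sub>A (br 1 a y * br 1 x b) = sandwich x y (a * b)"
    and "(\<delta> * \<delta>) *\<^sub>A (br 1 x b * br 1 a y) = sandwich x y (b * a)"
proof -
  have comm: "a * (x * m) = x * (a * m)" "b * (y * m) = y * (b * m)"
    and yx: "y * (x * m) = x * (y * m)" for m
    by (simp_all add: assms flip: mult.assoc)
  have split: "(\<delta> * \<delta>) *\<^sub>A (c * d)
      = (\<delta> *\<^sub>A c) * (\<delta> *\<^sub>A d)" for c d
    by (simp add: scaleA_mult_left scaleA_mult_right)
  show "(\<delta> * \<delta>) *\<^sub>A (br 1 a y * br 1 x b) = sandwich x y (a * b)"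
    unfolding split br_scaled sandwich_def
    by (simp add: expand comm yx assms(1) assms(2)[symmetric] assms(3))
  show "(\<delta> * \<delta>) *\<^sub>A (br 1 x b * br 1 a y) = sandwich x y (b * a)"
    unfolding split br_scaled sandwich_def
    by (simp add: expand comm yx [symmetric] assms(1) assms(2)[symmetric] assms(3))
qed

lemma sandwich_linear:
  "sandwich x y (c *\<^sub>A m - d *\<^sub>A n) = c *\<^sub>A sandwich x y m - d *\<^sub>A sandwich x y n"
  by (simp add: sandwich_def expand mult.commute)

lemma br_br_sandwich:
  assumes "x * y = y * x" and "x * a = a * x" and "b * y = y * b"
  shows "(\<delta> * \<delta>) *\<^sub>A br 2 (br 1 a y) (br 1 x b)
    = sandwich x y (br 2 a b)"
proof (rule scaleA_cancel [OF qp_2_diff_nonzero])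
  have "\<delta> *\<^sub>A (\<delta> * \<delta>) *\<^sub>A br 2 (br 1 a y) (br 1 x b)
      = (\<delta> * \<delta>) *\<^sub>A (\<delta> *\<^sub>A br 2 (br 1 a y) (br 1 x b))"
    by (simp only: A.scale_scale mult_ac)
  also have "\<dots> = qp 2 *\<^sub>A ((\<delta> * \<delta>) *\<^sub>A (br 1 a y * br 1 x b))
      - qp (-2) *\<^sub>A ((\<delta> * \<delta>) *\<^sub>A (br 1 x b * br 1 a y))"
    unfolding br_scaled A.scale_right_diff_distrib A.scale_scale by (simp only: mult_ac)
  also have "\<dots> = sandwich x y (\<delta> *\<^sub>A br 2 a b)"
    unfolding br_mult_br [OF assms] br_scaled sandwich_linear ..
  also have "\<dots> = \<delta> *\<^sub>A sandwich x y (br 2 a b)"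
    using sandwich_linear [of x y \<delta> "br 2 a b" 0 0] by simp
  finally show "\<delta> *\<^sub>A (\<delta> * \<delta>) *\<^sub>A br 2 (br 1 a y) (br 1 x b) = \<delta> *\<^sub>A sandwich x y (br 2 a b)" .
qed

text \<open>The left-hand side and the first term on the right are invariant under \<open>i \<mapsto> i + 3\<close>, the latter because
\<open>O\<^sub>i\<^sub>,\<^sub>i\<^sub>+\<^sub>1\<close> commutes with its antipode. So the last term is invariant too, although its letters are
replaced by different ones.\<close>

lemma theta_sandwich:
  "(\<delta> * \<delta>) *\<^sub>A br 2 (o3 (i+2)) (o3 i)
   = (qp (-2) * (q + 1)) *\<^sub>A ((\<delta> * \<delta>) *\<^sub>A (o2 (i+3) * o2 i))
     - \<theta> *\<^sub>A sandwich (o1 i) (o1 (i+4)) (o1 (i+5))"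
proof -
  have c: "o1 i * o1 (i+4) = o1 (i+4) * o1 i" "o1 i * o2 (i+2) = o2 (i+2) * o1 i"
    "o2 (i+1) * o1 (i+4) = o1 (i+4) * o2 (i+1)" "o1 i * o1 (i+3) = o1 (i+3) * o1 i"
    "o1 (i+1) * o1 (i+4) = o1 (i+4) * o1 (i+1)" "o1 (i+1) * o1 (i+3) = o1 (i+3) * o1 (i+1)"
    using o2_o1_commute_3 [of "i+1"] o2_o1_commute_4 [of "i+2"] o_periodic(1) [of i]
    by (simp_all add: add.assoc o1_commute)
  have o3: "o3 (i+2) = br 1 (o2 (i+2)) (o1 (i+4))" "o3 i = br 1 (o1 i) (o2 (i+1))"
    using br_o2_o1_next [of "i+2"] br_o1_o2_prev [of "i+1"] by (simp_all add: add.assoc)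
  have o2: "o2 (i+3) = br 1 (o1 (i+3)) (o1 (i+4))" "o2 i = br 1 (o1 i) (o1 (i+1))"
    using br_o1_o1 [of "i+3"] br_o1_o1 [of "i"] by (simp_all add: add.assoc)
  have R4: "br 2 (o2 (i+2)) (o2 (i+1))
      = (qp (-2) * (q + 1)) *\<^sub>A (o1 (i+3) * o1 (i+1)) - \<theta> *\<^sub>A o1 (i+5)"
    using br_o2_o2_overlap [of "i+1"] c by (simp add: add.assoc)
  show ?thesis
    unfolding o3 br_br_sandwich [OF c(1-3)] R4 sandwich_linear o2
      br_mult_br(1) [OF c(1) c(4) c(5)] ..
qed

text \<open>The last term of \<open>theta_sandwich\<close> with the two ends exchanged is a multiple of \<open>[[O\<^sub>i\<^sub>+\<^sub>4, O\<^sub>i\<^sub>+\<^sub>5], O\<^sub>i]\<close>, a triple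
generator, and thus invariant under \<open>i \<mapsto> i + 3\<close>, since these have period 3. The difference of the two
terms is \<open>\<theta> \<delta>\<close> times the left-hand side.\<close>

lemma antipodal_triples:
  "o1 i * o1 (i+5) * o1 (i+4) - o1 (i+4) * o1 (i+5) * o1 i
   = o1 (i+3) * o1 (i+2) * o1 (i+1) - o1 (i+1) * o1 (i+2) * o1 (i+3)"
proof (rule scaleA_cancel [OF theta_nonzero], rule scaleA_cancel [OF qp_2_diff_nonzero])
  have per: "o1 (i+6) = o1 i" "o1 (i+7) = o1 (i+1)" "o1 (i+8) = o1 (i+2)" "o2 (i+6) = o2 i"
    "o3 (i+5) = o3 (i+2)" "o3 (i+3) = o3 i" "o3 (i+4) = o3 (i+1)"
    using o_periodic(1) [of i] o_periodic(1) [of "i+1"] o_periodic(1) [of "i+2"]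
      o_periodic(2) [of i] o_periodic(3) [of i] o_periodic(3) [of "i+1"] o_periodic(3) [of "i+2"]
    by (simp_all add: add.assoc)
  have eq1: "\<theta> *\<^sub>A sandwich (o1 i) (o1 (i+4)) (o1 (i+5))
      = \<theta> *\<^sub>A sandwich (o1 (i+3)) (o1 (i+1)) (o1 (i+2))"
    using theta_sandwich [of i] theta_sandwich [of "i+3"] o2_o2_commute [of i]
    by (simp add: add.assoc per)
  have o3: "br 1 (br 1 (o1 (i+4)) (o1 (i+5))) (o1 i) = o3 (i+1)"
    "br 1 (br 1 (o1 (i+1)) (o1 (i+2))) (o1 (i+3)) = o3 (i+1)"
    using br_o1_o1 [of "i+4"] br_o2_o1_next [of "i+4"]  br_o1_o1 [of "i+1"] br_o2_o1_next [of "i+1"]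
    by (simp_all add: add.assoc per)
  have eq2: "(qp 2 *\<^sub>A (o1 (i+4) * o1 (i+5) * o1 i) - o1 (i+5) * o1 (i+4) * o1 i
        - o1 i * o1 (i+4) * o1 (i+5) + qp (-2) *\<^sub>A (o1 i * o1 (i+5) * o1 (i+4)))
      = (qp 2 *\<^sub>A (o1 (i+1) * o1 (i+2) * o1 (i+3)) - o1 (i+2) * o1 (i+1) * o1 (i+3)
        - o1 (i+3) * o1 (i+1) * o1 (i+2) + qp (-2) *\<^sub>A (o1 (i+3) * o1 (i+2) * o1 (i+1)))"
    unfolding br_br_scaled [symmetric] o3 ..
  have c: "o1 (i+4) * o1 i = o1 i * o1 (i+4)" "o1 (i+3) * o1 (i+1) = o1 (i+1) * o1 (i+3)"
    by (simp_all add: o1_commute)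
  \<comment> \<open>The subtrahend is \<open>\<delta>\<^sup>2 [[y, m], x]\<close>.\<close>
  have diff: "\<delta> *\<^sub>A (x * m * y - y * m * x) = sandwich x y m
      - (qp 2 *\<^sub>A (y * m * x) - m * y * x - x * y * m + qp (-2) *\<^sub>A (x * m * y))"
    if "y * x = x * y" for x y m
    using that by (simp add: sandwich_def expand)
  have "\<delta> *\<^sub>A \<theta> *\<^sub>A (x * m * y - y * m * x) = \<theta> *\<^sub>A sandwich x y m
      - \<theta> *\<^sub>A (qp 2 *\<^sub>A (y * m * x) - m * y * x - x * y * m + qp (-2) *\<^sub>A (x * m * y))"
    if "y * x = x * y" for x y m
    unfolding A.scale_left_commute [of \<delta>] diff [OF that] by (rule A.scale_right_diff_distrib)
  from this [OF c(1), of "o1 (i+5)"] this [OF c(2) [symmetric], of "o1 (i+2)"]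
  show "\<delta> *\<^sub>A \<theta> *\<^sub>A (o1 i * o1 (i+5) * o1 (i+4) - o1 (i+4) * o1 (i+5) * o1 i)
   = \<delta> *\<^sub>A \<theta> *\<^sub>A (o1 (i+3) * o1 (i+2) * o1 (i+1) - o1 (i+1) * o1 (i+2) * o1 (i+3))"
    unfolding eq1 eq2 by simp
qed

text \<open>The commutator with all crossings reversed differs from \<open>O\<^sub>i\<^sub>,\<^sub>i\<^sub>+\<^sub>1\<^sub>,\<^sub>i\<^sub>+\<^sub>2\<close> by the antisymmetric
expression in \<open>antipodal_triples\<close>, and thus inherits its antipodal symmetry.\<close>

lemma reversed_triple:
  "(\<delta> * \<delta>) *\<^sub>A br 1 (o1 (i+2)) (br 1 (o1 (i+1)) (o1 i))
   = (\<delta> * \<delta>) *\<^sub>A o3 i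
     + \<delta> *\<^sub>A (o1 (i+2) * o1 (i+1) * o1 i - o1 i * o1 (i+1) * o1 (i+2))"
proof -
  have c: "o1 (i+2) * o1 i = o1 i * o1 (i+2)" "o1 (i+2) * (o1 i * m) = o1 i * (o1 (i+2) * m)" for m
    by (simp_all add: o1_commute flip: mult.assoc)
  have "o3 i = br 1 (br 1 (o1 i) (o1 (i+1))) (o1 (i+2))"
    by (simp add: br_o1_o1 br_o2_o1_next)
  then show ?thesis
    unfolding br_assoc [OF c(1)] by (simp only: br_br_scaled) (simp add: expand c)
qed

lemma reversed_triple_antipodal:
  "br 1 (o1 (i+2)) (br 1 (o1 (i+1)) (o1 i)) = br 1 (o1 (i+5)) (br 1 (o1 (i+4)) (o1 (i+3)))"
proof (rule scaleA_cancel)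
  show "\<delta> * \<delta> \<noteq> 0"
    using qp_2_diff_nonzero by simp
  have "o3 (i+3) = o3 i"
    by (rule o_periodic(3))
  have "o1 (i+2) * o1 (i+1) * o1 i - o1 i * o1 (i+1) * o1 (i+2)
      = o1 (i+5) * o1 (i+4) * o1 (i+3) - o1 (i+3) * o1 (i+4) * o1 (i+5)"
    using antipodal_triples [of "i+2"] o_periodic(1) [of i] o_periodic(1) [of "i+1"] o_periodic(1) [of "i+2"]
    by (simp add: add.assoc)
  then show "(\<delta> * \<delta>) *\<^sub>A br 1 (o1 (i+2)) (br 1 (o1 (i+1)) (o1 i))
      = (\<delta> * \<delta>) *\<^sub>A br 1 (o1 (i+5)) (br 1 (o1 (i+4)) (o1 (i+3)))"
    using reversed_triple [of i] reversed_triple [of "i+3"] \<open>o3 (i+3) = o3 i\<close>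
    by (simp only: add.assoc numeral_plus_numeral numeral_plus_one add_num_simps)
qed

text \<open>The part of the right-hand sides of \<open>R6a\<close>, \<open>R6b\<close>, \<open>R6c\<close> that is not visibly invariant under
\<open>i \<mapsto> i + 3\<close>.\<close>

definition R6_cubic :: "int \<Rightarrow> Aqt" where
  "R6_cubic i = - (\<theta> *\<^sub>A (o1 i * o1 (i+4) * o1 (i+5))) + (\<theta> * qp (-1)) *\<^sub>A (o1 (i+4) * o2 (i+5))
    + (\<theta> * qp 1) *\<^sub>A (o1 i * o2 (i+4))"

text \<open>After \<open>O\<^sub>i\<^sub>+\<^sub>4\<^sub>,\<^sub>i\<^sub>+\<^sub>5\<close> and \<open>O\<^sub>i\<^sub>+\<^sub>5\<^sub>,\<^sub>i\<close> are written as commutators, all other terms cancel and, up to a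
scalar, one side of \<open>antipodal_triples\<close> remains.\<close>

lemma R6_cubic_antipodal: "R6_cubic (i+3) = R6_cubic i"
proof -
  have key: "\<delta> *\<^sub>A R6_cubic i
      = \<theta> *\<^sub>A (o1 (i+4) * o1 (i+5) * o1 i - o1 i * o1 (i+5) * o1 (i+4))" for i
  proof -
    have o2: "o2 (i+5) = br 1 (o1 (i+5)) (o1 i)" "o2 (i+4) = br 1 (o1 (i+4)) (o1 (i+5))"
      using br_o1_o1 [of "i+5"] br_o1_o1 [of "i+4"] o_periodic(1) [of i]
      by (simp_all add: add.assoc)
    have c: "o1 (i+4) * o1 i = o1 i * o1 (i+4)" "o1 (i+4) * (o1 i * m) = o1 i * (o1 (i+4) * m)" for m
      by (simp_all add: o1_commute flip: mult.assoc)
    have "R6_cubic i = \<theta> *\<^sub>A (- (o1 i * o1 (i+4) * o1 (i+5)) + qp (-1) *\<^sub>A (o1 (i+4) * o2 (i+5))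
        + qp 1 *\<^sub>A (o1 i * o2 (i+4)))"
      by (simp add: R6_cubic_def A.scale_right_distrib A.scale_right_diff_distrib)
    then have "\<delta> *\<^sub>A R6_cubic i = \<theta> *\<^sub>A (\<delta> *\<^sub>A (- (o1 i * o1 (i+4) * o1 (i+5)))
        + qp (-1) *\<^sub>A (o1 (i+4) * (\<delta> *\<^sub>A o2 (i+5)))
        + qp 1 *\<^sub>A (o1 i * (\<delta> *\<^sub>A o2 (i+4))))"
      by (simp only: A.scale_right_distrib A.scale_scale scaleA_mult_right mult_ac)
    also have "\<dots> = \<theta> *\<^sub>A (o1 (i+4) * o1 (i+5) * o1 i - o1 i * o1 (i+5) * o1 (i+4))"
      unfolding o2 br_scaled by (rule arg_cong [of _ _ "scaleA \<theta>"]) (simp add: expand c)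
    finally show ?thesis .
  qed
  have per: "o1 (i+6) = o1 i" "o1 (i+7) = o1 (i+1)" "o1 (i+8) = o1 (i+2)"
    using o_periodic(1) [of i] o_periodic(1) [of "i+1"] o_periodic(1) [of "i+2"]
    by (simp_all add: add.assoc)
  have "o1 (i+1) * o1 (i+2) * o1 (i+3) - o1 (i+3) * o1 (i+2) * o1 (i+1)
      = o1 (i+4) * o1 (i+5) * o1 i - o1 i * o1 (i+5) * o1 (i+4)"
    using antipodal_triples [of i] by (metis minus_diff_eq)
  with key [of "i+3"] have "\<delta> *\<^sub>A R6_cubic (i+3) = \<delta> *\<^sub>A R6_cubic i"
    by (simp only: key [of i] add.assoc numeral_plus_numeral add_num_simps per)
  then show ?thesis
    by (rule scaleA_cancel [OF qp_2_diff_nonzero])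
qed


section \<open>The rotation respects the relations\<close>

lemma extend_rotation:
  "extend I_gen (A1 i) = o1 (i + 1)" "extend I_gen (A2 i) = o2 (i + 1)"
  "extend I_gen (A3 i) = o3 (i + 1)"
proof -
  define r where "r = (i - 1) mod 6"
  have "(i + 1 - 1) mod 6 = (r + 1) mod 6" "(i - 1) mod 3 = r mod 3" "(i + 1 - 1) mod 3 = (r + 1) mod 3"
    unfolding r_def by presburger+
  moreover have "extend I_gen (X ([O1, O2, O3, O4, O5, O6] ! nat r))
      = extend Og (X ([O1, O2, O3, O4, O5, O6] ! nat ((r + 1) mod 6))) \<and>
    extend I_gen (X ([O12, O23, O34, O45, O56, O61] ! nat r))
      = extend Og (X ([O12, O23, O34, O45, O56, O61] ! nat ((r + 1) mod 6))) \<and>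
    extend I_gen (X ([O123, O234, O345] ! nat (r mod 3)))
      = extend Og (X ([O123, O234, O345] ! nat ((r + 1) mod 3)))"
  proof -
    have "r = 0 \<or> r = 1 \<or> r = 2 \<or> r = 3 \<or> r = 4 \<or> r = 5"
      unfolding r_def by presburger
    then show ?thesis
      by (elim disjE) (simp_all add: extend_X)
  qed
  ultimately show "extend I_gen (A1 i) = o1 (i + 1)" "extend I_gen (A2 i) = o2 (i + 1)"
    "extend I_gen (A3 i) = o3 (i + 1)"
    unfolding o1_def o2_def o3_def A1_def A2_def A3_def r_def [symmetric] by (simp_all only:)
qed

lemma rotation_satisfies_relations: "satisfies_relations I_gen"
  unfolding satisfies_relations_def
proof (intro allI impI)
  fix f g
  assume "f \<doteq> g"
  then show "extend I_gen f = extend I_gen g"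
  proof cases
    case (R1b i j)
    then show ?thesis
      using o1_commute [of "i+1" "j+1"] by (simp add: extend_simps extend_rotation)
  next
    case R6a
    then show ?thesis
      using relation_holds [OF R6b] by (simp add: extend_qbr extend_simps)
  next
    case R6b
    then show ?thesis
      using relation_holds [OF R6c] by (simp add: extend_qbr extend_simps)
  next
    case R6c
    \<comment> \<open>The image of \<open>R6c\<close> is the antipode of \<open>R6a\<close>, not a defining relation.\<close>
    have c: "o1 6 * o1 3 = o1 3 * o1 6"
      by (simp add: o1_commute)
    have "o1 7 = o1 1" "o1 8 = o1 2" "o1 9 = o1 3"  "o2 8 = o2 2" "o2 9 = o2 3"
      using o_periodic(1) [of 1] o_periodic(1) [of 2] o_periodic(1) [of 3] o_periodic(2) [of 2]
        o_periodic(2) [of 3]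
      by simp_all
    with R6_cubic_antipodal [of 1]
    have "- (\<theta> *\<^sub>A (Og O1 * Og O5 * Og O6)) + (\<theta> * qp (-1)) *\<^sub>A (Og O5 * Og O61)
       + (\<theta> * qp 1) *\<^sub>A (Og O1 * Og O56) =
       - (\<theta> *\<^sub>A (Og O4 * Og O2 * Og O3)) + (\<theta> * qp (-1)) *\<^sub>A (Og O2 * Og O34)
       + (\<theta> * qp 1) *\<^sub>A (Og O4 * Og O23)"
      by (simp add: R6_cubic_def Og_eq)
    with R6c show ?thesis
      using relation_holds [OF R6a] c by (simp add: extend_qbr extend_simps flip: Og_eq)
  next
    case R7
    have "extend I_gen q_casimir = extend Og q_casimir"
      by (simp add: q_casimir_def extend_simps power2_eq_square add_ac)
    with R7 relation_holds [OF defrel.R7] show ?thesis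
      by (simp add: extend_simps)
  qed (use relations [of "i+1" for i] in
       \<open>simp_all add: extend_qbr extend_simps extend_rotation add.assoc\<close>)
qed


section \<open>Doublets\<close>

definition doublet :: "Aqt \<Rightarrow> Aqt \<Rightarrow> Aqt \<Rightarrow> bool" where
  "doublet x a b \<longleftrightarrow> br 1 a x = b \<and> br 1 x b = a"

text \<open>The two equations of a doublet, solved for the words that end in \<open>x\<close>. Used from left to right, they move
\<open>x\<close> to the front of a word.\<close>

lemma doublet_exchange:
  assumes "doublet x a b"
  shows "a * x = qp (-2) *\<^sub>A (x * a) + qp 1 *\<^sub>A b - qp (-3) *\<^sub>A b"
    and "b * x = qp 2 *\<^sub>A (x * b) - qp 3 *\<^sub>A a + qp (-1) *\<^sub>A a"
proof -
  from assms have "qp 1 *\<^sub>A (a * x) = qp (-1) *\<^sub>A (x * a) + (qp 2 *\<^sub>A b - qp (-2) *\<^sub>A b)"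
    by (simp add: doublet_def br_eq_iff algebra_simps)
  then have "qp (-1) *\<^sub>A (qp 1 *\<^sub>A (a * x))
      = qp (-1) *\<^sub>A (qp (-1) *\<^sub>A (x * a) + (qp 2 *\<^sub>A b - qp (-2) *\<^sub>A b))"
    by simp
  then show "a * x = qp (-2) *\<^sub>A (x * a) + qp 1 *\<^sub>A b - qp (-3) *\<^sub>A b"
    by (simp add: expand)
  from assms have "qp (-1) *\<^sub>A (b * x) = qp 1 *\<^sub>A (x * b) - (qp 2 *\<^sub>A a - qp (-2) *\<^sub>A a)"
    by (simp add: doublet_def br_eq_iff algebra_simps)
  then have "qp 1 *\<^sub>A (qp (-1) *\<^sub>A (b * x))
      = qp 1 *\<^sub>A (qp 1 *\<^sub>A (x * b) - (qp 2 *\<^sub>A a - qp (-2) *\<^sub>A a))"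
    by simp
  then show "b * x = qp 2 *\<^sub>A (x * b) - qp 3 *\<^sub>A a + qp (-1) *\<^sub>A a"
    by (simp add: expand algebra_simps)
qed

text \<open>A doublet \<open>(a\<^sub>0, a\<^sub>1)\<close> continues to a sequence with \<open>a\<^sub>n\<^sub>+\<^sub>1 = q\<^sup>1\<^sup>/\<^sup>4 x a\<^sub>n - q\<^sup>1\<^sup>/\<^sup>2 a\<^sub>n\<^sub>-\<^sub>1\<close>, along which the twist
shifts the index. Four of the generators are such an \<open>a\<^sub>1\<close>, and \<open>d\<^sub>1\<close> is defined by this formula on them.\<close>

lemma doublet_next:
  assumes "doublet x a b"
  shows "doublet x b (qp 1 *\<^sub>A (x * b) - qp 2 *\<^sub>A a)"
  using doublet_exchange(1)[OF assms] doublet_exchange(2)[OF assms]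
  by (simp add: doublet_def br_eq_iff expand)

text \<open>Write \<open>L\<close> and \<open>R\<close> for left and right multiplication by \<open>x\<close>. Then this is
\<open>(R - L) (q\<^sup>1\<^sup>/\<^sup>2 R - q\<^sup>-\<^sup>1\<^sup>/\<^sup>2 L)\<close>, which vanishes on the elements that commute with \<open>x\<close>.\<close>

definition twist_operator :: "Aqt \<Rightarrow> Aqt \<Rightarrow> Aqt" where
  "twist_operator x m = qp 2 *\<^sub>A (m * x * x) - (qp 2 + qp (-2)) *\<^sub>A (x * m * x) + qp (-2) *\<^sub>A (x * x * m)"

definition twist_coeff :: kfield where
  "twist_coeff = \<delta> * \<delta> * (qp 2 + qp (-2))"

lemma twist_coeff_nonzero: "twist_coeff \<noteq> 0"
  using qp_2_diff_nonzero qp_2_sum_nonzero by (simp add: twist_coeff_def)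

text \<open>The heart of the construction: on products of two doublets, the twist does not depend on the factors
but only on the product. On one doublet the twist is \<open>\<delta>\<^sup>-\<^sup>1 (q\<^sup>1\<^sup>/\<^sup>4 R - q\<^sup>-\<^sup>1\<^sup>/\<^sup>4 L)\<close>, and the doublet equations are a
quadratic equation between \<open>L\<close> and \<open>R\<close>. For a product, \<open>x\<close> also occurs between the factors;
subtracting the quadratic equations of the two factors shows that on the image of \<open>R - L\<close> this middle
\<open>x\<close> acts as \<open>(L + R) / (q\<^sup>1\<^sup>/\<^sup>2 + q\<^sup>-\<^sup>1\<^sup>/\<^sup>2)\<close> and can be eliminated.\<close>

lemma twist_product:
  assumes "doublet x a a'" and "doublet x b b'"
  shows "twist_coeff *\<^sub>A (a' * b' - a * b) = twist_operator x (a * b)"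
proof -
  note ex = doublet_exchange [OF assms(1)] doublet_exchange [OF assms(2)]
  have ex': "a * (x * m) = (qp (-2) *\<^sub>A (x * a) + qp 1 *\<^sub>A a' - qp (-3) *\<^sub>A a') * m"
    "a' * (x * m) = (qp 2 *\<^sub>A (x * a') - qp 3 *\<^sub>A a + qp (-1) *\<^sub>A a) * m" for m
    by (simp_all flip: ex mult.assoc)
  show ?thesis
    by (simp add: twist_operator_def twist_coeff_def expand ex ex')
qed

lemma twist_operator_linear:
  "twist_operator x (a + b) = twist_operator x a + twist_operator x b"
  "twist_operator x (c *\<^sub>A a) = c *\<^sub>A twist_operator x a"
  by (simp_all add: twist_operator_def expand mult.commute)


section \<open>The twist respects the relations\<close>

abbreviation curve :: Aqt where "curve \<equiv> Og O1"

abbreviation twisted :: "free_alg \<Rightarrow> Aqt" where "twisted \<equiv> extend d1_gen"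

abbreviation plain :: "free_alg \<Rightarrow> Aqt" where "plain \<equiv> extend Og"

text \<open>The degree counts the letters that do not commute with \<open>O\<^sub>1\<close>, that is, the intersections with the curve
of the twist. Each predicate records how \<open>d\<^sub>1\<close> acts on elements of this degree; those of degree 0
are also covered by \<open>deg2\<close>.\<close>

definition deg0 :: "free_alg \<Rightarrow> bool" where
  "deg0 f \<longleftrightarrow> twisted f = plain f \<and> plain f * curve = curve * plain f"

definition deg1 :: "free_alg \<Rightarrow> bool" where
  "deg1 f \<longleftrightarrow> doublet curve (plain f) (twisted f)"

definition deg2 :: "free_alg \<Rightarrow> bool" where
  "deg2 f \<longleftrightarrow> twist_coeff *\<^sub>A (twisted f - plain f) = twist_operator curve (plain f)"

lemma deg_add: "deg0 f \<Longrightarrow> deg0 g \<Longrightarrow> deg0 (f + g)" "deg1 f \<Longrightarrow> deg1 g \<Longrightarrow> deg1 (f + g)"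
  "deg2 f \<Longrightarrow> deg2 g \<Longrightarrow> deg2 (f + g)"
proof -
  show "deg0 f \<Longrightarrow> deg0 g \<Longrightarrow> deg0 (f + g)"
    by (simp add: deg0_def extend_simps algebra_simps)
  show "deg1 f \<Longrightarrow> deg1 g \<Longrightarrow> deg1 (f + g)"
    by (simp add: deg1_def doublet_def extend_simps br_linear)
  assume "deg2 f" "deg2 g"
  then have *: "twist_coeff *\<^sub>A (twisted f - plain f) = twist_operator curve (plain f)"
      "twist_coeff *\<^sub>A (twisted g - plain g) = twist_operator curve (plain g)"
    by (simp_all add: deg2_def)
  show "deg2 (f + g)"
    unfolding deg2_def extend_simps twist_operator_linear *[symmetric] by (simp add: algebra_simps)
qed

lemma deg_scale: "deg0 f \<Longrightarrow> deg0 (c *\<^sub>F f)" "deg1 f \<Longrightarrow> deg1 (c *\<^sub>F f)" "deg2 f \<Longrightarrow> deg2 (c *\<^sub>F f)"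
proof -
  show "deg0 f \<Longrightarrow> deg0 (c *\<^sub>F f)"
    by (simp add: deg0_def extend_simps scaleA_mult_left scaleA_mult_right)
  show "deg1 f \<Longrightarrow> deg1 (c *\<^sub>F f)"
    by (simp add: deg1_def doublet_def extend_simps br_linear)
  assume "deg2 f"
  then show "deg2 (c *\<^sub>F f)"
    unfolding deg2_def extend_simps twist_operator_linear A.scale_right_diff_distrib [symmetric]
      A.scale_left_commute [of twist_coeff] by simp
qed

lemma deg_minus: "deg0 f \<Longrightarrow> deg0 (- f)" "deg1 f \<Longrightarrow> deg1 (- f)" "deg2 f \<Longrightarrow> deg2 (- f)"
  using deg_scale [of f "- 1"] by simp_all

lemma deg_diff: "deg0 f \<Longrightarrow> deg0 g \<Longrightarrow> deg0 (f - g)" "deg1 f \<Longrightarrow> deg1 g \<Longrightarrow> deg1 (f - g)"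
  "deg2 f \<Longrightarrow> deg2 g \<Longrightarrow> deg2 (f - g)"
  using deg_add [of f "- g"] deg_minus [of g] by simp_all

lemma deg_mult:
  "deg0 f \<Longrightarrow> deg0 g \<Longrightarrow> deg0 (f * g)" "deg0 f \<Longrightarrow> deg1 g \<Longrightarrow> deg1 (f * g)"
  "deg1 f \<Longrightarrow> deg0 g \<Longrightarrow> deg1 (f * g)" "deg1 f \<Longrightarrow> deg1 g \<Longrightarrow> deg2 (f * g)"
proof -
  show "deg0 f \<Longrightarrow> deg0 g \<Longrightarrow> deg0 (f * g)"
    by (simp add: deg0_def extend_simps) (metis mult.assoc)
qed (simp_all add: deg0_def deg1_def deg2_def doublet_def [of _ "_ * _"] extend_simps br_commute
    twist_product, simp_all add: doublet_def)

lemma deg_mult_2_0: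
  assumes "deg2 f" and "deg0 g"
  shows "deg2 (f * g)"
proof -
  have comm: "plain g * curve = curve * plain g" "plain g * (curve * m) = curve * (plain g * m)" for m
    using assms(2) by (simp_all add: deg0_def flip: mult.assoc)
  have "twist_operator curve (plain f * plain g) = twist_operator curve (plain f) * plain g"
    by (simp add: twist_operator_def expand comm)
  also have "\<dots> = (twist_coeff *\<^sub>A (twisted f - plain f)) * plain g"
    using assms(1) by (simp only: deg2_def)
  also have "\<dots> = twist_coeff *\<^sub>A (twisted f * plain g - plain f * plain g)"
    by (simp only: scaleA_mult_left left_diff_distrib)
  finally show ?thesis
    using assms(2) by (simp add: deg2_def deg0_def extend_simps)
qed

lemma deg2_if_deg0: "deg0 f \<Longrightarrow> deg2 f"
  by (simp add: deg0_def deg2_def twist_operator_def mult.assoc algebra_simps)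

lemma deg0_1: "deg0 1"
  by (simp add: deg0_def extend_simps)

lemma deg0_gen: "deg0 (X O1)" "deg0 (X O3)" "deg0 (X O4)" "deg0 (X O5)" "deg0 (X O34)" "deg0 (X O45)"
  "deg0 (X O345)"
  using o2_o1_commute_4 [of 3] o2_o1_commute_3 [of 4] o3_o1_commute [of 0]
    o_periodic(1) [of 1] o_periodic(3) [of 0]
  by (simp_all add: deg0_def extend_X Og_eq o1_commute)

lemma doublets: "doublet curve (Og O12) (Og O2)" "doublet curve (Og O6) (Og O61)"
  "doublet curve (Og O123) (Og O23)" "doublet curve (Og O56) (Og O234)"
  using br_o1_o1 [of 1] br_o2_o1 [of 1] br_o1_o1 [of 6] br_o1_o2 [of 6]
    br_o1_o2_prev [of 2] br_o3_o1 [of 1] br_o2_o1_next [of 5] br_o1_o3 [of 5]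
    o_periodic(1) [of 1] o_periodic(3) [of 2]
  by (simp_all add: doublet_def Og_eq)

lemma deg1_gen: "deg1 (X O2)" "deg1 (X O6)" "deg1 (X O12)" "deg1 (X O61)" "deg1 (X O23)"
  "deg1 (X O123)" "deg1 (X O56)" "deg1 (X O234)"
  using doublets doublets [THEN doublet_next] by (simp_all add: deg1_def extend_X)

lemmas deg_rules = deg0_gen deg1_gen deg0_1 deg_add deg_diff deg_minus deg_scale deg_mult deg_mult_2_0 deg2_if_deg0

definition homogeneous :: "free_alg \<Rightarrow> free_alg \<Rightarrow> bool" where
  "homogeneous f g \<longleftrightarrow> deg1 f \<and> deg1 g \<or> deg2 f \<and> deg2 g"

text \<open>On each of the two kinds of elements, the twisted value is a function of the plain value.\<close>

lemma homogeneous_twisted: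
  assumes "homogeneous f g" and "plain f = plain g"
  shows "twisted f = twisted g"
  using assms(1) unfolding homogeneous_def
proof
  assume "deg1 f \<and> deg1 g"
  with assms(2) show ?thesis
    unfolding deg1_def doublet_def by metis
next
  assume "deg2 f \<and> deg2 g"
  then have "twist_coeff *\<^sub>A (twisted f - plain f) = twist_coeff *\<^sub>A (twisted g - plain g)"
    by (simp only: deg2_def assms(2))
  then have "twisted f - plain f = twisted g - plain g"
    by (rule scaleA_cancel [OF twist_coeff_nonzero])
  then show ?thesis
    unfolding assms(2) by simp
qed

lemma deg1_qbr: "deg1 (f * g) \<Longrightarrow> deg1 (g * f) \<Longrightarrow> deg1 (qbr j f g)"
  and deg2_qbr: "deg2 (f * g) \<Longrightarrow> deg2 (g * f) \<Longrightarrow> deg2 (qbr j f g)"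
  by (simp_all add: qbr_def deg_diff deg_scale)

lemma homogeneous_casimir: "homogeneous q_casimir 0"
proof -
  have "deg2 (0 :: free_alg)"
    using deg_scale(3) [of 1 0] by (simp add: deg2_if_deg0 deg0_1)
  moreover have "deg2 q_casimir"
    unfolding q_casimir_def power2_eq_square
    by (intro deg_add(3) deg_diff(3) deg_scale(3); (simp add: deg_rules; fail)?)
  ultimately show ?thesis
    by (simp add: homogeneous_def)
qed

text \<open>These turn the index \<open>6 k + r\<close>, shifted by a constant, into a numeral; they are used to check
a relation for each residue class.\<close>

lemma A_mod_6: "A1 (6 * k + r) = A1 r" "A2 (6 * k + r) = A2 r" "A3 (6 * k + r) = A3 r"
  "A1 (6 * k) = A1 0" "A2 (6 * k) = A2 0" "A3 (6 * k) = A3 0"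
  "A1 (6 * k - r) = A1 (- r)" "A3 (6 * k - r) = A3 (- r)"
  "A1 (r + 6 * k) = A1 r" "A3 (r + 6 * k) = A3 r"
proof -
  show *: "A1 (6 * k + r) = A1 r" "A2 (6 * k + r) = A2 r" "A3 (6 * k + r) = A3 r" for r
    using mod_mult_self4 [of 6 k "r - 1"] mod_mult_self4 [of 3 "2 * k" "r - 1"]
    by (simp_all add: A1_def A2_def A3_def add_diff_eq)
  from * [of 0] * [of "- r"] show "A1 (6 * k) = A1 0" "A2 (6 * k) = A2 0" "A3 (6 * k) = A3 0"
    "A1 (6 * k - r) = A1 (- r)" "A3 (6 * k - r) = A3 (- r)"
    "A1 (r + 6 * k) = A1 r" "A3 (r + 6 * k) = A3 r"
    using * [of r] by (simp_all add: add.commute)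
qed

lemma mod_6_cases:
  fixes i :: int
  obtains k where "i = 6 * k" | k where "i = 6 * k + 1" | k where "i = 6 * k + 2"
  | k where "i = 6 * k + 3" | k where "i = 6 * k + 4" | k where "i = 6 * k + 5"
proof -
  have "i mod 6 = 0 \<or> i mod 6 = 1 \<or> i mod 6 = 2 \<or> i mod 6 = 3 \<or> i mod 6 = 4 \<or> i mod 6 = 5"
    by presburger
  with that [of "i div 6"] mult_div_mod_eq [of 6 i] show thesis
    by (elim disjE) simp_all
qed

lemma deg_A1: "deg0 (A1 i) \<or> deg1 (A1 i)"
  by (cases i rule: mod_6_cases, simp_all add: A_mod_6) (simp_all add: A1_def deg_rules)

lemma defrel_homogeneous: "f \<doteq> g \<Longrightarrow> homogeneous f g"
proof (induction rule: defrel.induct)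
  case (R1b i j)
  then show ?case
    using deg_A1 [of i] deg_A1 [of j] by (auto simp: homogeneous_def deg_rules)
next
  case R7
  show ?case by (rule homogeneous_casimir)
next
  case R6a show ?case by (simp add: homogeneous_def deg_rules deg1_qbr deg2_qbr)
next
  case R6b show ?case by (simp add: homogeneous_def deg_rules deg1_qbr deg2_qbr)
next
  case R6c show ?case by (simp add: homogeneous_def deg_rules deg1_qbr deg2_qbr)
next
  case (R1a i) show ?case
    by (cases i rule: mod_6_cases, simp_all add: A_mod_6)
      (simp_all add: A1_def A2_def A3_def homogeneous_def deg_rules deg1_qbr deg2_qbr)
next
  case (R2a i) show ?case
    by (cases i rule: mod_6_cases, simp_all add: A_mod_6)
      (simp_all add: A1_def A2_def A3_def homogeneous_def deg_rules deg1_qbr deg2_qbr)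
next
  case (R2b i) show ?case
    by (cases i rule: mod_6_cases, simp_all add: A_mod_6)
      (simp_all add: A1_def A2_def A3_def homogeneous_def deg_rules deg1_qbr deg2_qbr)
next
  case (R2c i) show ?case
    by (cases i rule: mod_6_cases, simp_all add: A_mod_6)
      (simp_all add: A1_def A2_def A3_def homogeneous_def deg_rules deg1_qbr deg2_qbr)
next
  case (R2d i) show ?case
    by (cases i rule: mod_6_cases, simp_all add: A_mod_6)
      (simp_all add: A1_def A2_def A3_def homogeneous_def deg_rules deg1_qbr deg2_qbr)
next
  case (R2e i) show ?case
    by (cases i rule: mod_6_cases, simp_all add: A_mod_6)
      (simp_all add: A1_def A2_def A3_def homogeneous_def deg_rules deg1_qbr deg2_qbr)
next
  case (R2f i) show ?case
    by (cases i rule: mod_6_cases, simp_all add: A_mod_6)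
      (simp_all add: A1_def A2_def A3_def homogeneous_def deg_rules deg1_qbr deg2_qbr)
next
  case (R3a i) show ?case
    by (cases i rule: mod_6_cases, simp_all add: A_mod_6)
      (simp_all add: A1_def A2_def A3_def homogeneous_def deg_rules deg1_qbr deg2_qbr)
next
  case (R3b i) show ?case
    by (cases i rule: mod_6_cases, simp_all add: A_mod_6)
      (simp_all add: A1_def A2_def A3_def homogeneous_def deg_rules deg1_qbr deg2_qbr)
next
  case (R3c i) show ?case
    by (cases i rule: mod_6_cases, simp_all add: A_mod_6)
      (simp_all add: A1_def A2_def A3_def homogeneous_def deg_rules deg1_qbr deg2_qbr)
next
  case (R4a i) show ?case
    by (cases i rule: mod_6_cases, simp_all add: A_mod_6)
      (simp_all add: A1_def A2_def A3_def homogeneous_def deg_rules deg1_qbr deg2_qbr)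
next
  case (R4b i) show ?case
    by (cases i rule: mod_6_cases, simp_all add: A_mod_6)
      (simp_all add: A1_def A2_def A3_def homogeneous_def deg_rules deg1_qbr deg2_qbr)
next
  case (R4c i) show ?case
    by (cases i rule: mod_6_cases, simp_all add: A_mod_6)
      (simp_all add: A1_def A2_def A3_def homogeneous_def deg_rules deg1_qbr deg2_qbr)
next
  case (R5a i) show ?case
    by (cases i rule: mod_6_cases, simp_all add: A_mod_6)
      (simp_all add: A1_def A2_def A3_def homogeneous_def deg_rules deg1_qbr deg2_qbr)
next
  case (R5b i) show ?case
    by (cases i rule: mod_6_cases, simp_all add: A_mod_6)
      (simp_all add: A1_def A2_def A3_def homogeneous_def deg_rules deg1_qbr deg2_qbr)
next
  case (R5c i) show ?case
    by (cases i rule: mod_6_cases, simp_all add: A_mod_6)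
      (simp_all add: A1_def A2_def A3_def homogeneous_def deg_rules deg1_qbr deg2_qbr)
qed

lemma twist_satisfies_relations: "satisfies_relations d1_gen"
  unfolding satisfies_relations_def
  using defrel_homogeneous homogeneous_twisted relation_holds by blast


section \<open>The rotation and the twists as endomorphisms\<close>

text \<open>\<open>R4b\<close> produces \<open>O\<^sub>4\<^sub>5 = [O\<^sub>0\<^sub>1, O\<^sub>2\<^sub>3]\<close>, from which the sixth generator \<open>O\<^sub>5 = [O\<^sub>4\<^sub>5, O\<^sub>4]\<close> is
recovered; all the others are commutators of these six.\<close>

lemma alg_hom_eqI_o1:
  assumes h: "alg_hom h" "alg_hom h'"
    and eq: "\<And>k. k \<in> {0, 1, 2, 3, 4} \<Longrightarrow> h (o1 (i + k)) = h' (o1 (i + k))"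
  shows "h = h'"
proof (rule alg_hom_eqI [OF h])
  note hom = h [THEN alg_hom_br]
  have eq0: "h (o1 i) = h' (o1 i)"
    using eq [of 0] by simp
  have o2: "o2 j = br 1 (o1 j) (o1 (j+1))" and o3: "o3 j = br 1 (o2 j) (o1 (j+2))" for j
    by (simp_all add: br_o1_o1 br_o2_o1_next)
  \<comment> \<open>The sixth index, which is not among the assumptions.\<close>
  have "o1 (i+5) = br 1 (br 1 (o2 i) (o2 (i+2))) (o1 (i+4))"
    using br_o2_o1 [of "i+4"] br_o2_o2 [of i] by (simp add: add.assoc)
  then have eq5: "h (o1 (i+5)) = h' (o1 (i+5))"
    using eq eq0 by (simp add: hom o2 add.assoc)
  have o1: "h (o1 j) = h' (o1 j)" for j
  proof -
    define k where "k = (j - i) mod 6"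
    have "o1 j = o1 (i + k)"
      by (rule o1_cong) (simp add: k_def mod_add_right_eq)
    moreover have "k = 0 \<or> k = 1 \<or> k = 2 \<or> k = 3 \<or> k = 4 \<or> k = 5"
      unfolding k_def by presburger
    ultimately show ?thesis
      using eq eq5 by auto
  qed
  have o2': "h (o2 j) = h' (o2 j)" for j
    by (simp add: o2 hom o1)
  have o3': "h (o3 j) = h' (o3 j)" for j
    by (simp add: o3 hom o1 o2')
  fix g
  show "h (Og g) = h' (Og g)"
    by (cases g) (simp_all add: Og_eq o1 o2' o3')
qed

definition rotation :: "Aqt \<Rightarrow> Aqt" where "rotation = induced I_gen"

definition dtwist1 :: "Aqt \<Rightarrow> Aqt" where "dtwist1 = induced d1_gen"

lemma alg_hom_rotation: "alg_hom rotation" and alg_hom_dtwist1: "alg_hom dtwist1"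
  by (simp_all add: rotation_def dtwist1_def alg_hom_induced rotation_satisfies_relations twist_satisfies_relations)

lemma rotation_o1: "rotation (o1 i) = o1 (i + 1)"
  using induced_extend_Og [OF rotation_satisfies_relations, of "A1 i"]
  by (simp add: rotation_def o1_def extend_rotation flip: o1_def)

text \<open>Integer powers, available before the rotation is known to be invertible.\<close>

definition rotation_pow :: "int \<Rightarrow> Aqt \<Rightarrow> Aqt" where "rotation_pow k = rotation ^^ nat (k mod 6)"

lemma alg_hom_rotation_pow: "alg_hom (rotation_pow k)"
proof -
  have "alg_hom (rotation ^^ n)" for n
    by (induction n) (simp_all only: funpow.simps alg_hom_id alg_hom_rotation alg_hom_comp)
  then show ?thesis
    by (simp add: rotation_pow_def)
qed

lemma rotation_pow_o1: "rotation_pow k (o1 i) = o1 (i + k)"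
proof -
  have "(rotation ^^ n) (o1 i) = o1 (i + int n)" for n
    by (induction n) (simp_all add: rotation_o1 add_ac)
  then have "rotation_pow k (o1 i) = o1 (i + k mod 6)"
    by (simp add: rotation_pow_def)
  also have "\<dots> = o1 (i + k)"
    by (rule o1_cong) (simp add: mod_add_right_eq)
  finally show ?thesis .
qed

lemma rotation_pow_add: "rotation_pow k \<circ> rotation_pow l = rotation_pow (k + l)"
  by (rule alg_hom_eqI_o1 [of _ _ 0]) (simp_all add: alg_hom_comp alg_hom_rotation_pow rotation_pow_o1 add_ac)

lemma rotation_pow_0: "rotation_pow 0 = id"
  and rotation_pow_1: "rotation_pow 1 = rotation"
  and rotation_pow_6: "rotation_pow 6 = id"
  by (simp_all add: rotation_pow_def)

lemma bij_rotation_pow: "bij (rotation_pow k)"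
  using rotation_pow_add [of k "- k"] rotation_pow_add [of "- k" k]
  by (intro o_bij [of "rotation_pow (- k)"]) (simp_all add: rotation_pow_0)

text \<open>Conjugates of \<open>d\<^sub>1\<close>, indexed by all integers modulo 6: the chain of five curves closes up to a cycle of
six.\<close>

definition dtwist :: "int \<Rightarrow> Aqt \<Rightarrow> Aqt" where
  "dtwist k = rotation_pow (k - 1) \<circ> dtwist1 \<circ> rotation_pow (1 - k)"

lemma alg_hom_dtwist: "alg_hom (dtwist k)"
  by (simp add: dtwist_def alg_hom_comp alg_hom_rotation_pow alg_hom_dtwist1)

lemma dtwist1_o1: "dtwist1 (o1 i) = (if (i - 1) mod 6 \<in> {1, 5} then br 1 (o1 i) (o1 1) else o1 i)"
proof -
  have tw: "dtwist1 (Og g) = d1_gen g" for g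
    by (simp add: dtwist1_def induced_Og twist_satisfies_relations)
  have br: "d1_gen O2 = br 1 (Og O2) (Og O1)" "d1_gen O6 = br 1 (Og O6) (Og O1)"
    using deg1_gen(1,2) by (simp_all add: deg1_def doublet_def extend_X del: d1_gen.simps)
  define r where "r = (i - 1) mod 6"
  have "o1 i = o1 (r + 1)"
    by (rule o1_cong) (simp add: r_def mod_add_left_eq)
  moreover have "r = 0 \<or> r = 1 \<or> r = 2 \<or> r = 3 \<or> r = 4 \<or> r = 5"
    unfolding r_def by presburger
  then have "dtwist1 (o1 (r + 1)) = (if r \<in> {1, 5} then br 1 (o1 (r + 1)) (o1 1) else o1 (r + 1))"
    using tw [of O1] tw [of O2] tw [of O3] tw [of O4] tw [of O5] tw [of O6] br
    by (elim disjE) (simp_all add: Og_eq del: d1_gen.simps(1-8))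
  ultimately show ?thesis
    unfolding r_def [symmetric] by simp
qed

lemma dtwist_o1: "dtwist k (o1 i) = (if (i - k) mod 6 \<in> {1, 5} then br 1 (o1 i) (o1 k) else o1 i)"
  by (simp add: dtwist_def rotation_pow_o1 dtwist1_o1 alg_hom_br [OF alg_hom_rotation_pow])

lemma dtwist_br: "dtwist k (br 1 a b) = br 1 (dtwist k a) (dtwist k b)"
  by (rule alg_hom_br [OF alg_hom_dtwist])


section \<open>The relations of the mapping class group\<close>

text \<open>On \<open>O\<^sub>i\<^sub>+\<^sub>1\<close> and \<open>O\<^sub>i\<^sub>+\<^sub>2\<close> this is the cancellation in \<open>br_adjacent\<close>, and on their outer neighbours it is
associativity of the commutator, which holds since \<open>O\<^sub>i\<close> commutes with \<open>O\<^sub>i\<^sub>+\<^sub>2\<close>.\<close>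

lemma dtwist_braid: "dtwist (i+1) \<circ> dtwist (i+2) \<circ> dtwist (i+1)
    = dtwist (i+2) \<circ> dtwist (i+1) \<circ> dtwist (i+2)"
proof (rule alg_hom_eqI_o1 [of _ _ i])
  have assoc: "br 1 (br 1 (o1 i) (o1 (i+1))) (o1 (i+2)) = br 1 (o1 i) (br 1 (o1 (i+1)) (o1 (i+2)))"
    "br 1 (br 1 (o1 (i+3)) (o1 (i+2))) (o1 (i+1)) = br 1 (o1 (i+3)) (br 1 (o1 (i+2)) (o1 (i+1)))"
    by (simp_all add: br_assoc o1_commute)
  fix j :: int
  assume "j \<in> {0, 1, 2, 3, 4}"
  then show "(dtwist (i+1) \<circ> dtwist (i+2) \<circ> dtwist (i+1)) (o1 (i + j))
      = (dtwist (i+2) \<circ> dtwist (i+1) \<circ> dtwist (i+2)) (o1 (i + j))"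
    using br_adjacent [of i] br_adjacent [of "i+1"]
    by (elim insertE emptyE) (simp_all add: dtwist_o1 dtwist_br assoc add.assoc)
qed (simp_all add: alg_hom_comp alg_hom_dtwist)

lemma dtwist_commute:
  assumes "(k - l) mod 6 \<in> {2, 3, 4}"
  shows "dtwist k \<circ> dtwist l = dtwist l \<circ> dtwist k"
proof (rule alg_hom_eqI_o1 [of _ _ 0])
  have kl: "(k - l) mod 6 \<notin> {0, 1, 5}" "(l - k) mod 6 \<notin> {0, 1, 5}"
    using assms by (auto; presburger)+
  then have c: "o1 k * o1 l = o1 l * o1 k" and "dtwist k (o1 l) = o1 l" "dtwist l (o1 k) = o1 k"
    by (simp_all add: o1_commute dtwist_o1)
  then show "(dtwist k \<circ> dtwist l) (o1 (0 + i)) = (dtwist l \<circ> dtwist k) (o1 (0 + i))" for i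
    by (simp add: dtwist_o1 [of _ i] dtwist_br br_right_commute)
qed (simp_all add: alg_hom_comp alg_hom_dtwist)

text \<open>For \<open>2 \<le> i \<le> 5\<close>, the twist \<open>d\<^sub>i\<^sub>-\<^sub>1\<close> sends \<open>O\<^sub>i\<close> to \<open>[O\<^sub>i, O\<^sub>i\<^sub>-\<^sub>1]\<close>, then \<open>d\<^sub>i\<close> sends this to \<open>O\<^sub>i\<^sub>-\<^sub>1\<close>, and the
others fix it. The image of \<open>O\<^sub>1\<close> is \<open>[O\<^sub>1, [O\<^sub>2, [O\<^sub>3, [O\<^sub>4, O\<^sub>5]]]]\<close>, which the relations collapse to \<open>[O\<^sub>1, O\<^sub>6\<^sub>1] = O\<^sub>6\<close>.\<close>

lemma dtwist_descending: "dtwist 5 \<circ> dtwist 4 \<circ> dtwist 3 \<circ> dtwist 2 \<circ> dtwist 1 = rotation_pow (-1)"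
proof (rule alg_hom_eqI_o1 [of _ _ 1])
  have "br 1 (o1 1) (br 1 (o1 2) (br 1 (o1 3) (br 1 (o1 4) (o1 5)))) = o1 0"
    using br_o1_o1 [of 4] br_o1_o2_prev [of 4] br_o1_o3 [of 0] br_o1_o2 [of 0]
      o_periodic(3) [of 0]
    by simp
  fix j :: int
  assume "j \<in> {0, 1, 2, 3, 4}"
  then show "(dtwist 5 \<circ> dtwist 4 \<circ> dtwist 3 \<circ> dtwist 2 \<circ> dtwist 1) (o1 (1 + j))
      = rotation_pow (-1) (o1 (1 + j))"
    using \<open>_ = o1 0\<close> br_adjacent(1) [of 1] br_adjacent(1) [of 2] br_adjacent(1) [of 3] br_adjacent(1) [of 4]
    by (elim insertE emptyE; simp add: dtwist_o1 dtwist_br rotation_pow_o1)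
qed (simp_all add: alg_hom_comp alg_hom_dtwist alg_hom_rotation_pow)

text \<open>Here \<open>O\<^sub>5\<close> is the difficult generator. Its image involves the reversed triple \<open>[O\<^sub>5, [O\<^sub>4, O\<^sub>3]]\<close>,
which is not a generator, and by \<open>reversed_triple_antipodal\<close> equals \<open>[O\<^sub>2, [O\<^sub>1, O\<^sub>6]]\<close>. The two remaining
twists then undo the commutators one at a time.\<close>

lemma dtwist_ascending: "dtwist 1 \<circ> dtwist 2 \<circ> dtwist 3 \<circ> dtwist 4 \<circ> dtwist 5 = rotation"
proof (rule alg_hom_eqI_o1 [of _ _ 1])
  have *: "br 1 (o1 5) (br 1 (o1 4) (o1 3)) = br 1 (o1 2) (br 1 (o1 1) (o1 6))"
    using reversed_triple_antipodal [of 3] o_periodic(1) [of 1] o_periodic(1) [of 2] by simp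
  have "dtwist 2 (br 1 (o1 5) (br 1 (o1 4) (o1 3))) = br 1 (o1 2) (br 1 (br 1 (o1 1) (o1 2)) (o1 6))"
    unfolding * by (simp add: dtwist_br dtwist_o1)
  also have "\<dots> = br 1 (br 1 (o1 2) (br 1 (o1 1) (o1 2))) (o1 6)"
    by (simp add: br_assoc o1_commute)
  also have "\<dots> = br 1 (o1 1) (o1 6)"
    using br_adjacent(1) [of 1] by simp
  finally have 5: "dtwist 1 (dtwist 2 (dtwist 3 (dtwist 4 (dtwist 5 (o1 5))))) = o1 6"
    using br_adjacent(1) [of 6] o_periodic(1) [of 1] by (simp add: dtwist_br dtwist_o1)
  fix j :: int
  assume "j \<in> {0, 1, 2, 3, 4}"
  then show "(dtwist 1 \<circ> dtwist 2 \<circ> dtwist 3 \<circ> dtwist 4 \<circ> dtwist 5) (o1 (1 + j)) = rotation (o1 (1 + j))"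
  proof (elim insertE emptyE)
    assume "j = 4" with 5 show ?thesis by (simp add: rotation_o1)
  qed (use br_adjacent(3) [of 1] br_adjacent(3) [of 2] br_adjacent(3) [of 3] br_adjacent(3) [of 4]
        br_adjacent(2) [of 1] br_adjacent(2) [of 2] br_adjacent(2) [of 3] br_adjacent(2) [of 4]
      in \<open>simp_all add: dtwist_o1 dtwist_br rotation_o1\<close>)
qed (simp_all add: alg_hom_comp alg_hom_dtwist alg_hom_rotation)

lemma dtwist_1: "dtwist 1 = dtwist1"
  by (simp add: dtwist_def rotation_pow_0)

text \<open>The descending product is invertible. It begins with \<open>d\<^sub>1\<close>, which is therefore injective, and ends with
\<open>d\<^sub>5\<close>, which is therefore surjective, and \<open>d\<^sub>5\<close> is conjugate to \<open>d\<^sub>1\<close>.\<close>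

lemma bij_dtwist1: "bij dtwist1"
proof (rule bijI)
  have descending: "dtwist 5 (dtwist 4 (dtwist 3 (dtwist 2 (dtwist 1 x)))) = rotation_pow (-1) x" for x
    using fun_cong [OF dtwist_descending, of x] by simp
  have inj: "inj (rotation_pow k)" and surj: "surj (rotation_pow k)" for k
    using bij_rotation_pow by (simp_all add: bij_def)
  show "inj dtwist1"
  proof (rule injI)
    fix x y
    assume "dtwist1 x = dtwist1 y"
    then have "rotation_pow (-1) x = rotation_pow (-1) y"
      unfolding descending [symmetric] dtwist_1 by simp
    with inj show "x = y"
      by (rule injD)
  qed
  have "\<exists>z. y = dtwist1 z" for y
  proof -
    obtain x where "rotation_pow 4 y = rotation_pow (-1) x"
      using surj by (metis surjD)
    also have "\<dots> = rotation_pow 4 (dtwist1 (rotation_pow (-4) (dtwist 4 (dtwist 3 (dtwist 2 (dtwist 1 x))))))"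
      unfolding descending [symmetric] dtwist_def [of 5] by simp
    finally show ?thesis
      by (auto dest: injD [OF inj])
  qed
  then show "surj dtwist1"
    unfolding surj_def by blast
qed

lemma bij_dtwist: "bij (dtwist k)"
  by (simp add: dtwist_def bij_comp bij_rotation_pow bij_dtwist1)


section \<open>Homomorphisms out of the mapping class group\<close>

context group
begin

definition word_value :: "(dehn \<Rightarrow> 'a) \<Rightarrow> mword \<Rightarrow> 'a" where
  "word_value \<phi> w = foldr (\<lambda>(d, b) a. (if b then \<phi> d else inv \<phi> d) \<otimes> a) w \<one>"

lemma word_value_simps:
  "word_value \<phi> [] = \<one>" "word_value \<phi> ((d, b) # w) = (if b then \<phi> d else inv \<phi> d) \<otimes> word_value \<phi> w"
  by (simp_all add: word_value_def)

lemma word_value_closed: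
  assumes "\<And>d. \<phi> d \<in> carrier G"
  shows "word_value \<phi> w \<in> carrier G"
  by (induction w) (auto simp: word_value_simps assms)

lemma word_value_append:
  assumes "\<And>d. \<phi> d \<in> carrier G"
  shows "word_value \<phi> (u @ v) = word_value \<phi> u \<otimes> word_value \<phi> v"
  by (induction u) (auto simp: word_value_simps m_assoc word_value_closed assms)

lemma Mod_hom_if_relations:
  assumes closed: "\<And>d. \<phi> d \<in> carrier G"
    and rel: "\<And>u v. mod_rel u v \<Longrightarrow> word_value \<phi> u = word_value \<phi> v"
  obtains \<Phi> where "\<Phi> \<in> hom Mod_Sigma2 G" and "\<And>w. \<Phi> (abs_mclass w) = word_value \<phi> w"
proof
  have eq: "word_value \<phi> u = word_value \<phi> v" if "mod_eq u v" for u v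
    using that
  proof induction
    case (rel u v)
    then show ?case
      by (rule assms(2))
  next
    case (cancel d b)
    show ?case
      using closed [of d] by (simp add: word_value_simps)
  qed (simp_all add: word_value_append closed)
  show val: "(word_value \<phi> \<circ> rep_mclass) (abs_mclass w) = word_value \<phi> w" for w
    unfolding comp_def
    by (intro eq mclass.abs_eq_iff [THEN iffD1] Quotient3_abs_rep [OF Quotient3_mclass])
  show "word_value \<phi> \<circ> rep_mclass \<in> hom Mod_Sigma2 G"
  proof (rule homI)
    fix x y :: mclass
    obtain u v where "x = abs_mclass u" "y = abs_mclass v"
      using Quotient3_abs_rep [OF Quotient3_mclass] by metis
    then show "(word_value \<phi> \<circ> rep_mclass) (x \<otimes>\<^bsub>Mod_Sigma2\<^esub> y)
        = (word_value \<phi> \<circ> rep_mclass) x \<otimes> (word_value \<phi> \<circ> rep_mclass) y"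
      by (simp add: Mod_Sigma2_def mclass_mult.abs_eq val word_value_append closed del: comp_apply)
  qed (simp add: word_value_closed closed)
qed

end


section \<open>The action\<close>

fun twist_of :: "dehn \<Rightarrow> Aqt \<Rightarrow> Aqt" where
  "twist_of D1 = dtwist 1" | "twist_of D2 = dtwist 2" | "twist_of D3 = dtwist 3"
| "twist_of D4 = dtwist 4" | "twist_of D5 = dtwist 5"

interpretation Aut: group Aut_A
  by (rule group_Aut_A)

lemma Aut_A_simps: "f \<in> carrier Aut_A \<longleftrightarrow> bij f \<and> alg_hom f" "f \<otimes>\<^bsub>Aut_A\<^esub> g = f \<circ> g" "\<one>\<^bsub>Aut_A\<^esub> = id"
  by (simp_all add: Aut_A_def)

lemma twist_of_closed: "twist_of d \<in> carrier Aut_A"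
  by (cases d) (simp_all add: Aut_A_simps bij_dtwist alg_hom_dtwist)

lemma word_value_tw:
  assumes "i \<in> {1..5}"
  shows "Aut.word_value twist_of (tw i) = dtwist (int i)"
proof -
  have "i = 1 \<or> i = 2 \<or> i = 3 \<or> i = 4 \<or> i = 5"
    using assms by auto
  then show ?thesis
    by (elim disjE) (simp_all add: tw_def Aut.word_value_simps Aut_A_simps)
qed

lemma word_value_wI: "Aut.word_value twist_of wI = rotation"
  unfolding wI_def
  by (simp only: Aut.word_value_append [OF twist_of_closed])
     (simp add: word_value_tw Aut_A_simps comp_assoc flip: dtwist_ascending)

lemma word_value_wH: "Aut.word_value twist_of wH = id"
proof -
  have "Aut.word_value twist_of wH = (dtwist 1 \<circ> dtwist 2 \<circ> dtwist 3 \<circ> dtwist 4 \<circ> dtwist 5)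
      \<circ> (dtwist 5 \<circ> dtwist 4 \<circ> dtwist 3 \<circ> dtwist 2 \<circ> dtwist 1)"
    unfolding wH_def
    by (simp only: Aut.word_value_append [OF twist_of_closed])
       (simp add: word_value_tw Aut_A_simps comp_assoc)
  also have "\<dots> = rotation_pow 1 \<circ> rotation_pow (-1)"
    by (simp only: dtwist_ascending dtwist_descending rotation_pow_1)
  finally show ?thesis
    by (simp only: rotation_pow_add) (simp add: rotation_pow_0)
qed

lemma word_value_mod_rel: "mod_rel u v \<Longrightarrow> Aut.word_value twist_of u = Aut.word_value twist_of v"
proof (induction rule: mod_rel.induct)
  case (braid i)
  then show ?case
    using dtwist_braid [of "int i - 1"]
    by (simp add: Aut.word_value_append [OF twist_of_closed] word_value_tw Aut_A_simps comp_assoc add.commute)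
next
  case (commute i j)
  then have "(int i - int j) mod 6 \<in> {2, 3, 4}"
    by (auto; presburger)
  from dtwist_commute [OF this] commute show ?case
    by (simp add: Aut.word_value_append [OF twist_of_closed] word_value_tw Aut_A_simps)
next
  case I_order
  have "rotation \<circ> (rotation \<circ> (rotation \<circ> (rotation \<circ> (rotation \<circ> rotation)))) = rotation_pow 6"
    by (simp add: rotation_pow_add flip: rotation_pow_1)
  then show ?case
    by (simp add: Aut.word_value_append [OF twist_of_closed] word_value_wI Aut.word_value_simps Aut_A_simps rotation_pow_6)
next
  case H_order
  show ?case
    by (simp add: Aut.word_value_append [OF twist_of_closed] word_value_wH Aut.word_value_simps Aut_A_simps)
next
  case (H_central i)
  show ?case
    by (simp add: Aut.word_value_append [OF twist_of_closed] word_value_wH Aut_A_simps)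
qed

lemma rotation_int_pow: "rotation [^]\<^bsub>Aut_A\<^esub> k = rotation_pow k" for k :: int
proof -
  have carrier: "rotation_pow k \<in> carrier Aut_A" for k
    by (simp add: Aut_A_simps bij_rotation_pow alg_hom_rotation_pow)
  have nat: "rotation [^]\<^bsub>Aut_A\<^esub> int n = rotation_pow (int n)" for n
  proof (induction n)
    case 0
    show ?case
      by (simp add: rotation_pow_0 Aut_A_simps)
  next
    case (Suc n)
    have "rotation [^]\<^bsub>Aut_A\<^esub> int (Suc n) = rotation_pow (int n) \<circ> rotation_pow 1"
      using Suc by (simp only: int_pow_int Aut.nat_pow_Suc Aut_A_simps rotation_pow_1)
    then show ?case
      by (simp add: rotation_pow_add add.commute)
  qed
  show ?thesis
  proof (cases "k \<ge> 0")
    case True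
    then show ?thesis
      using nat [of "nat k"] by simp
  next
    case False
    have "inv\<^bsub>Aut_A\<^esub> rotation_pow (- k) = rotation_pow k"
      by (rule Aut.inv_equality) (simp_all add: carrier Aut_A_simps(2,3) rotation_pow_add rotation_pow_0)
    with False show ?thesis
      using nat [of "nat (- k)"] Aut.int_pow_neg [of rotation "- k"] carrier [of 1] by (simp add: rotation_pow_1)
  qed
qed

theorem theorem8:
  shows "\<exists>I d\<^sub>1. I \<in> carrier Aut_A \<and> (\<forall>g. I (Og g) = I_gen g) \<and>
           d\<^sub>1 \<in> carrier Aut_A \<and> (\<forall>g. d\<^sub>1 (Og g) = d1_gen g) \<and>
           (\<exists>\<Phi> \<in> hom Mod_Sigma2 Aut_A.
              (\<forall>i \<in> {1..5}. \<Phi> (dehn_twist i) =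
                 I [^]\<^bsub>Aut_A\<^esub> (int i - 1) \<otimes>\<^bsub>Aut_A\<^esub> d\<^sub>1 \<otimes>\<^bsub>Aut_A\<^esub> I [^]\<^bsub>Aut_A\<^esub> (1 - int i)) \<and>
              \<Phi> (dehn_twist 1 \<otimes>\<^bsub>Mod_Sigma2\<^esub> dehn_twist 2 \<otimes>\<^bsub>Mod_Sigma2\<^esub> dehn_twist 3
                 \<otimes>\<^bsub>Mod_Sigma2\<^esub> dehn_twist 4 \<otimes>\<^bsub>Mod_Sigma2\<^esub> dehn_twist 5) = I)"
proof -
  obtain \<Phi> where hom: "\<Phi> \<in> hom Mod_Sigma2 Aut_A"
    and val: "\<And>w. \<Phi> (abs_mclass w) = Aut.word_value twist_of w"
    using Aut.Mod_hom_if_relations [OF twist_of_closed word_value_mod_rel] by blast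
  have "\<Phi> (dehn_twist i)
      = rotation [^]\<^bsub>Aut_A\<^esub> (int i - 1) \<otimes>\<^bsub>Aut_A\<^esub> dtwist1 \<otimes>\<^bsub>Aut_A\<^esub> rotation [^]\<^bsub>Aut_A\<^esub> (1 - int i)"
    if "i \<in> {1..5}" for i
    using that
    by (simp add: dehn_twist.abs_eq val word_value_tw dtwist_def rotation_int_pow Aut_A_simps(2))
  moreover have "\<Phi> (dehn_twist 1 \<otimes>\<^bsub>Mod_Sigma2\<^esub> dehn_twist 2 \<otimes>\<^bsub>Mod_Sigma2\<^esub> dehn_twist 3
      \<otimes>\<^bsub>Mod_Sigma2\<^esub> dehn_twist 4 \<otimes>\<^bsub>Mod_Sigma2\<^esub> dehn_twist 5) = rotation"
  proof -
    have "dehn_twist 1 \<otimes>\<^bsub>Mod_Sigma2\<^esub> dehn_twist 2 \<otimes>\<^bsub>Mod_Sigma2\<^esub> dehn_twist 3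
      \<otimes>\<^bsub>Mod_Sigma2\<^esub> dehn_twist 4 \<otimes>\<^bsub>Mod_Sigma2\<^esub> dehn_twist 5 = abs_mclass wI"
      by (simp add: Mod_Sigma2_def dehn_twist.abs_eq mclass_mult.abs_eq wI_def)
    then show ?thesis
      by (simp only: val word_value_wI)
  qed
  moreover have "rotation \<in> carrier Aut_A" "dtwist1 \<in> carrier Aut_A"
    using bij_rotation_pow [of 1] by (simp_all add: Aut_A_simps bij_dtwist1 alg_hom_rotation alg_hom_dtwist1 rotation_pow_1)
  moreover have "rotation (Og g) = I_gen g" "dtwist1 (Og g) = d1_gen g" for g
    by (simp_all add: rotation_def dtwist1_def induced_Og rotation_satisfies_relations twist_satisfies_relations)
  ultimately show ?thesis
    using hom by blast
qed

end
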